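(* Let $d\ge 2$. There are constants $\epsilon>0$ and $\kappa_d>0$, depending only on the dimension $d$, such that for all $r$ large enough and for any configuration $\eta\in\mathbb{N}^{\mathbb{Z}^d}$ of explorers located outside $B(0,2r)$ (that is, $\eta(z)=0$ for all $z\in B(0,2r)$) with $|\eta|\le \epsilon\, r^d$, the internal DLA cluster $A(\eta)$ satisfies $$P\big(0\in A(\eta)\big)\le \exp\Big(-\kappa_2\,\frac{r^2}{\log r}\Big)\quad\text{if } d=2,$$ $$P\big(0\in A(\eta)\big)\le \exp\big(-\kappa_d\, r^2\big)\quad\text{if } d\ge 3.$$
   Context: For $z\in\mathbb{R}^d$ and $\rho>0$, $B(z,\rho)=\{x\in\mathbb{Z}^d:\ \|x-z\|<\rho\}$ is the trace on $\mathbb{Z}^d$ of the Euclidean ball of center $z$ and radius $\rho$, where $\|\cdot\|$ is the Euclidean norm. A configuration is an element $\eta\in\mathbb{N}^{\mathbb{Z}^d}$, where $\mathbb{N}=\{0,1,2,\dots\}$ and $\eta(z)$ is the number of random walks initially at $z$; $|\eta|=\sum_{z\in\mathbb{Z}^d}\eta(z)$ is the total number of walks. Internal DLA: let $|\eta|<\infty$. Choose an arbitrary ordering of the $|\eta|$ walks. The cluster is initially empty (all sites are empty). Following the ordering, one at a time, run each walk as an independent simple symmetric nearest-neighbor random walk on $\mathbb{Z}^d$ started at its initial site. When the running walk is on an empty site (a site not yet in the cluster, possibly its initial site), it stops (settles) there, that site is added to the cluster, and then the next walk is sent. Walks following these settling rules are called explorers. The final cluster, after all walks have settled, is the random subset $A(\eta)\subset\mathbb{Z}^d$,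 which contains exactly $|\eta|$ sites; its law does not depend on the chosen ordering (abelian property). $P$ is the probability governing the walks. *)

theory Defs
  imports "HOL-Probability.Probability"
begin

text \<open>
  The lattice \<open>\<int>\<^sup>d\<close> is the type \<open>int ^ 'd\<close> with \<open>d = CARD('d)\<close>.
\<close>

definition lattice_vec :: "int ^ 'd \<Rightarrow> real ^ 'd" where
  "lattice_vec x = (\<chi> i. real_of_int (x $ i))"

definition lattice_ball :: "real ^ 'd \<Rightarrow> real \<Rightarrow> (int ^ 'd) set" where
  "lattice_ball z \<rho> = {x. norm (lattice_vec x - z) < \<rho>}"

definition configs :: "(int ^ 'd \<Rightarrow> nat) set" where
  "configs = {\<eta>. finite {z. \<eta> z \<noteq> 0}}"

definition num_walks :: "(int ^ 'd \<Rightarrow> nat) \<Rightarrow> nat" where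
  "num_walks \<eta> = (\<Sum>z | \<eta> z \<noteq> 0. \<eta> z)"

text \<open>
  An ordering of the walks of \<open>\<eta>\<close> is given by the list of their successive starting sites.
\<close>

definition walk_orderings :: "(int ^ 'd \<Rightarrow> nat) \<Rightarrow> (int ^ 'd) list set" where
  "walk_orderings \<eta> = {xs. \<forall>z. count_list xs z = \<eta> z}"

definition unit_steps :: "(int ^ 'd) set" where
  "unit_steps = (\<Union>i. {axis i 1, axis i (- 1)})"

text \<open>
  A sample point \<open>\<omega>\<close> assigns to \<open>(k, t)\<close> the \<open>t\<close>-th increment of the \<open>k\<close>-th walk; under the
  measure below all increments are independent and uniform on the unit steps.
\<close>

definition walk_space :: "(nat \<times> nat \<Rightarrow> int ^ 'd) measure" where
  "walk_space = (\<Pi>\<^sub>M _\<in>UNIV. measure_pmf (pmf_of_set unit_steps))"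

definition walk :: "(nat \<times> nat \<Rightarrow> int ^ 'd) \<Rightarrow> nat \<Rightarrow> int ^ 'd \<Rightarrow> nat \<Rightarrow> int ^ 'd" where
  "walk \<omega> k x t = x + (\<Sum>s<t. \<omega> (k, s))"

text \<open>
  The second case concerns a path that never leaves the finite set \<open>A\<close>, which for the walks
  considered here is an event of probability zero.
\<close>

definition settle :: "(int ^ 'd) set \<Rightarrow> (nat \<Rightarrow> int ^ 'd) \<Rightarrow> (int ^ 'd) set" where
  "settle A S = (if \<exists>t. S t \<notin> A then insert (S (LEAST t. S t \<notin> A)) A else A)"

primrec cluster_after :: "(int ^ 'd) list \<Rightarrow> nat \<Rightarrow> (nat \<times> nat \<Rightarrow> int ^ 'd) \<Rightarrow> (int ^ 'd) set" where
  "cluster_after xs 0 \<omega> = {}"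
| "cluster_after xs (Suc k) \<omega> = settle (cluster_after xs k \<omega>) (walk \<omega> k (xs ! k))"

definition idla_cluster :: "(int ^ 'd) list \<Rightarrow> (nat \<times> nat \<Rightarrow> int ^ 'd) \<Rightarrow> (int ^ 'd) set" where
  "idla_cluster xs \<omega> = cluster_after xs (length xs) \<omega>"

lemma finite_unit_steps: "finite (unit_steps :: (int ^ 'd) set)"
  and unit_steps_nonempty: "(unit_steps :: (int ^ 'd) set) \<noteq> {}"
  by (auto simp: unit_steps_def)

lemma prob_space_walk_space: "prob_space (walk_space :: (nat \<times> nat \<Rightarrow> int ^ 'd) measure)"
  unfolding walk_space_def by (intro prob_space_PiM prob_space_measure_pmf)

lemma measurable_increment:
  "(\<lambda>\<omega>. \<omega> p) \<in> measurable (walk_space :: (nat \<times> nat \<Rightarrow> int ^ 'd) measure) (count_space UNIV)"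
proof -
  have "(\<lambda>\<omega>. \<omega> p) \<in> measurable (walk_space :: (nat \<times> nat \<Rightarrow> int ^ 'd) measure)
          (measure_pmf (pmf_of_set unit_steps))"
    unfolding walk_space_def by (rule measurable_component_singleton) simp
  then show ?thesis by simp
qed

lemma measurable_walk:
  "(\<lambda>\<omega>. walk \<omega> k x t) \<in> measurable (walk_space :: (nat \<times> nat \<Rightarrow> int ^ 'd) measure) (count_space UNIV)"
proof (induction t)
  case 0
  show ?case by (simp add: walk_def)
next
  case (Suc t)
  have "(\<lambda>\<omega>. walk \<omega> k x t + \<omega> (k, t)) \<in> measurable walk_space (count_space (UNIV :: (int ^ 'd) set))"
  proof (rule measurable_compose_countable'[OF _ Suc])
    fix y :: "int ^ 'd"
    show "(\<lambda>\<omega>. y + \<omega> (k, t)) \<in> measurable walk_space (count_space UNIV)"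
      by (rule measurable_compose[OF measurable_increment]) simp
  qed simp
  then show ?case by (simp add: walk_def add.assoc)
qed

lemma measurable_settle:
  fixes A :: "(int ^ 'd) set"
  assumes "finite A"
  shows "(\<lambda>\<omega>. settle A (walk \<omega> k x)) \<in> measurable walk_space (count_space (Collect finite))"
proof -
  have P: "Measurable.pred walk_space (\<lambda>\<omega>. walk \<omega> k x t \<notin> A)" for t
    by (rule measurable_compose[OF measurable_walk]) simp
  have L: "(\<lambda>\<omega>. LEAST t. walk \<omega> k x t \<notin> A) \<in> measurable walk_space (count_space UNIV)"
    by (rule measurable_Least) (use P in simp)
  have W: "(\<lambda>\<omega>. walk \<omega> k x (LEAST t. walk \<omega> k x t \<notin> A)) \<in> measurable walk_space (count_space UNIV)"
    by (rule measurable_compose_countable'[OF measurable_walk L]) simp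
  have I: "(\<lambda>\<omega>. insert (walk \<omega> k x (LEAST t. walk \<omega> k x t \<notin> A)) A)
      \<in> measurable walk_space (count_space (Collect finite))"
    by (rule measurable_compose[OF W]) (use assms in simp)
  have E: "Measurable.pred walk_space (\<lambda>\<omega>. \<exists>t. walk \<omega> k x t \<notin> A)"
    using P by measurable
  show ?thesis
    unfolding settle_def by (rule measurable_If[OF I _ E[unfolded pred_def]]) (use assms in simp)
qed

lemma measurable_cluster_after:
  "cluster_after (xs :: (int ^ 'd) list) k \<in> measurable walk_space (count_space (Collect finite))"
proof (induction k)
  case 0
  show ?case by simp
next
  case (Suc k)
  show ?case
    unfolding cluster_after.simps
    by (rule measurable_compose_countable'[OF measurable_settle Suc])
       (auto simp: uncountable_infinite countable_Collect_finite)
qed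

lemma idla_event_measurable:
  "{\<omega> \<in> space walk_space. z \<in> idla_cluster xs \<omega>} \<in> sets walk_space"
proof -
  have "Measurable.pred walk_space (\<lambda>\<omega>. z \<in> idla_cluster xs \<omega>)"
    unfolding idla_cluster_def by (rule measurable_compose[OF measurable_cluster_after]) simp
  then show ?thesis by (simp add: pred_def)
qed

end

theory Submission
  imports Defs
begin

text \<open>
  A shell of width \<open>w\<close> (in the sup norm) that contains at most a small multiple of \<open>w ^ d\<close> points of
  a finite set \<open>A\<close> is crossed inside \<open>A\<close> with probability at most \<open>1/4\<close>: by a discrete Faber--Krahn
  argument the walk spends little time in that thin set, so it leaves \<open>A\<close> before it has travelled the
  distance \<open>w\<close>. Hence a walk from outside settles at depth \<open>j\<close>, that is, behind \<open>j\<close> disjoint thin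
  shells of \<open>A\<close>, with probability at most \<open>4 ^ (- j)\<close>. So the product over \<open>x \<in> A\<close> of
  \<open>1 + \<theta> * 2 ^ depth x\<close> grows in expectation by a factor at most \<open>1 + 2 * \<theta>\<close> per walk.

  If the cluster reaches \<open>0\<close>, it meets all levels, and choosing thin shells greedily from outside
  produces shells of widths \<open>w\<^sub>0, w\<^sub>1, \<dots>\<close> with sum of order \<open>r\<close>, the \<open>l\<close>-th one containing of order
  \<open>w\<^sub>l ^ d\<close> points of depth at least \<open>l\<close>. The logarithm of the product is therefore at least
  of order \<open>\<Sum>l. ln (1 + \<theta> * 2 ^ l) * w\<^sub>l ^ d\<close>, and with \<open>\<theta> = r powr (2 - d)\<close> for \<open>d \<ge> 3\<close>
  and \<open>\<theta> = 1 / ln r\<close> for \<open>d = 2\<close> this sum is at least of order \<open>\<theta> * r ^ d\<close>: the shells with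
  \<open>\<theta> * 2 ^ l < 1\<close> have geometrically decreasing widths, and for the others the weight is linear
  in \<open>l\<close>. Since the \<open>\<epsilon> * r ^ d\<close> walks only contribute \<open>2 * \<epsilon> * \<theta> * r ^ d\<close>, Markov's inequality concludes.
\<close>

section \<open>Sup norm, square norm and the averaging operator\<close>

text \<open>Valued in \<open>nat\<close>, so that shells are integer intervals of levels and a step
  of the walk never jumps over a level.\<close>

definition sup_norm :: "int ^ 'd \<Rightarrow> nat" where
  "sup_norm x = Max (range (\<lambda>i. nat \<bar>x $ i\<bar>))"

definition sq_norm :: "int ^ 'd \<Rightarrow> real" where
  "sq_norm x = (\<Sum>i\<in>UNIV. (real_of_int (x $ i))\<^sup>2)"

definition avg :: "(int ^ 'd \<Rightarrow> real) \<Rightarrow> int ^ 'd \<Rightarrow> real" where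
  "avg h x = (\<Sum>e\<in>unit_steps. h (x + e)) / real (card (unit_steps :: (int ^ 'd) set))"

lemma sup_norm_le_iff: "sup_norm x \<le> n \<longleftrightarrow> (\<forall>i. \<bar>x $ i\<bar> \<le> int n)"
proof -
  have "nat \<bar>x $ i\<bar> \<le> n \<longleftrightarrow> \<bar>x $ i\<bar> \<le> int n" for i
    by linarith
  then show ?thesis by (auto simp: sup_norm_def)
qed

lemma abs_component_le_sup_norm: "\<bar>x $ i\<bar> \<le> int (sup_norm x)"
  using sup_norm_le_iff[of x "sup_norm x"] by simp

lemma sup_norm_zero [simp]: "sup_norm 0 = 0"
  using sup_norm_le_iff[of 0 0] by simp

lemma sup_norm_add_le: "sup_norm (x + y) \<le> sup_norm x + sup_norm y"
  unfolding sup_norm_le_iff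
proof
  fix i show "\<bar>(x + y) $ i\<bar> \<le> int (sup_norm x + sup_norm y)"
    using abs_component_le_sup_norm[of x i] abs_component_le_sup_norm[of y i] by simp
qed

lemma sup_norm_uminus [simp]: "sup_norm (- x) = sup_norm x"
  by (simp add: sup_norm_def)

lemma sup_norm_le_add_diff: "sup_norm x \<le> sup_norm y + sup_norm (x - y)"
  using sup_norm_add_le[of y "x - y"] by simp

lemma sup_norm_minus_commute: "sup_norm (x - y) = sup_norm (y - x)"
  using sup_norm_uminus[of "x - y"] by simp

lemma sup_norm_unit_step: "e \<in> unit_steps \<Longrightarrow> sup_norm e \<le> 1"
  unfolding sup_norm_le_iff by (auto simp: unit_steps_def axis_def)

lemma sup_norm_step:
  assumes "e \<in> unit_steps"
  shows "sup_norm (x + e) \<le> Suc (sup_norm x)" "sup_norm x \<le> Suc (sup_norm (x + e))"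
  using sup_norm_add_le[of x e] sup_norm_le_add_diff[of x "x + e"] sup_norm_unit_step[OF assms] by auto

lemma power2_sup_norm_le_sq_norm: "(real (sup_norm x))\<^sup>2 \<le> sq_norm x"
proof -
  have "sup_norm x \<in> range (\<lambda>i. nat \<bar>x $ i\<bar>)"
    unfolding sup_norm_def by (rule Max_in) auto
  then obtain i where i: "sup_norm x = nat \<bar>x $ i\<bar>" by auto
  have "(real (sup_norm x))\<^sup>2 = (real_of_int (x $ i))\<^sup>2"
    by (simp add: i)
  also have "\<dots> \<le> sq_norm x"
    unfolding sq_norm_def by (rule member_le_sum) auto
  finally show ?thesis .
qed

lemma sq_norm_nonneg: "0 \<le> sq_norm x"
  by (simp add: sq_norm_def sum_nonneg)

lemma sq_norm_zero [simp]: "sq_norm 0 = 0"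
  by (simp add: sq_norm_def)

lemma norm_lattice_vec_le: "norm (lattice_vec (x :: int ^ 'd)) \<le> real CARD('d) * real (sup_norm x)"
proof -
  have "norm (lattice_vec x) \<le> (\<Sum>i\<in>UNIV. \<bar>lattice_vec x $ i\<bar>)"
    by (rule norm_le_l1_cart)
  also have "\<dots> \<le> (\<Sum>i\<in>(UNIV :: 'd set). real (sup_norm x))"
  proof (rule sum_mono)
    fix i show "\<bar>lattice_vec x $ i\<bar> \<le> real (sup_norm x)"
      using abs_component_le_sup_norm[of x i] by (simp add: lattice_vec_def)
  qed
  finally show ?thesis by simp
qed

lemma card_unit_steps_pos: "0 < card (unit_steps :: (int ^ 'd) set)"
  using finite_unit_steps unit_steps_nonempty by (simp add: card_gt_0_iff)

lemma uminus_unit_steps: "uminus ` unit_steps = (unit_steps :: (int ^ 'd) set)"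
proof -
  have "- e \<in> unit_steps" if "e \<in> unit_steps" for e :: "int ^ 'd"
    using that by (auto simp: unit_steps_def vec_eq_iff axis_def)
  then show ?thesis
    by (metis (no_types, lifting) image_eqI image_subsetI minus_minus subsetI subset_antisym)
qed

lemma sum_unit_steps_uminus:
  "(\<Sum>e\<in>(unit_steps :: (int ^ 'd) set). h (- e)) = (\<Sum>e\<in>unit_steps. h e)"
proof -
  have "(\<Sum>e\<in>uminus ` (unit_steps :: (int ^ 'd) set). h e) = (\<Sum>e\<in>unit_steps. h (- e))"
    by (subst sum.reindex) (auto simp: inj_on_def)
  then show ?thesis by (simp add: uminus_unit_steps)
qed

lemma sq_norm_unit_step: "e \<in> unit_steps \<Longrightarrow> sq_norm e = 1"
proof -
  assume "e \<in> unit_steps"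
  then obtain j where "e = axis j 1 \<or> e = axis j (- 1)" by (auto simp: unit_steps_def)
  then have "(real_of_int (e $ i))\<^sup>2 = (if i = j then 1 else 0)" for i
    by (auto simp: axis_def)
  then show ?thesis by (simp add: sq_norm_def)
qed

text \<open>Pairing \<open>e\<close> with \<open>- e\<close> cancels the linear terms. The drift 1
  is what \<open>mean_exit_time\<close> loses per step inside its set, so averaging preserves the
  sum of the two there, the horizon shifting by one.\<close>

lemma avg_sq_norm:
  fixes x y :: "int ^ 'd"
  shows "avg (\<lambda>x. sq_norm (x - y)) x = sq_norm (x - y) + 1"
proof -
  let ?U = "unit_steps :: (int ^ 'd) set"
  define z where "z = x - y"
  have "sq_norm (z + e) + sq_norm (z + - e) = 2 * (sq_norm z + 1)" if "e \<in> ?U" for e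
  proof -
    have "sq_norm (z + e) + sq_norm (z + - e) = 2 * (sq_norm z + sq_norm e)"
      by (simp add: sq_norm_def sum_distrib_left flip: sum.distrib) (simp add: power2_eq_square algebra_simps)
    then show ?thesis using sq_norm_unit_step[OF that] by simp
  qed
  then have "(\<Sum>e\<in>?U. sq_norm (z + e)) + (\<Sum>e\<in>?U. sq_norm (z + - e)) = (\<Sum>e\<in>?U. 2 * (sq_norm z + 1))"
    by (simp flip: sum.distrib)
  then have "(\<Sum>e\<in>?U. sq_norm (z + e)) = real (card ?U) * (sq_norm z + 1)"
    using sum_unit_steps_uminus[of "\<lambda>e. sq_norm (z + e)"]
    by (simp add: algebra_simps)
  moreover have "avg (\<lambda>x. sq_norm (x - y)) x = (\<Sum>e\<in>?U. sq_norm (z + e)) / real (card ?U)"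
    unfolding avg_def by (simp add: z_def algebra_simps)
  ultimately show ?thesis
    using card_unit_steps_pos[where 'd='d] by (simp add: z_def)
qed

lemma avg_mono: "(\<And>e. e \<in> unit_steps \<Longrightarrow> h (x + e) \<le> h' (x + e)) \<Longrightarrow> avg h x \<le> avg h' x"
  unfolding avg_def by (intro divide_right_mono sum_mono) auto

lemma avg_const [simp]: "avg (\<lambda>_. c) (x :: int ^ 'd) = c"
  using card_unit_steps_pos[where 'd='d] by (simp add: avg_def)

lemma avg_add: "avg (\<lambda>x. h x + h' x) x = avg h x + avg h' x"
  by (simp add: avg_def sum.distrib add_divide_distrib)

lemma avg_cmult: "avg (\<lambda>x. c * h x) x = c * avg h x"
  by (simp add: avg_def sum_distrib_left)

lemma avg_nonneg: "(\<And>x. 0 \<le> h x) \<Longrightarrow> 0 \<le> avg h x"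
  unfolding avg_def by (intro divide_nonneg_nonneg sum_nonneg) auto

lemma avg_le: "(\<And>e. e \<in> unit_steps \<Longrightarrow> h (x + e) \<le> c) \<Longrightarrow> avg h x \<le> c"
  using avg_mono[of h x "\<lambda>_. c"] by simp

section \<open>Isoperimetry and mean exit times\<close>

definition edge_boundary :: "(int ^ 'd) set \<Rightarrow> ((int ^ 'd) \<times> (int ^ 'd)) set" where
  "edge_boundary B = {(x, e). x \<in> B \<and> e \<in> unit_steps \<and> x + e \<notin> B}"

lemma finite_edge_boundary: "finite B \<Longrightarrow> finite (edge_boundary B)"
  by (rule finite_subset[of _ "B \<times> unit_steps"]) (auto simp: edge_boundary_def finite_unit_steps)

text \<open>A point that stays in \<open>B\<close> under \<open>z\<close> but leaves it under
  \<open>z + w\<close> becomes, after the shift by \<open>z\<close>, a point moved out by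
  \<open>w\<close>.\<close>

lemma card_moved_out_add:
  fixes B :: "(int ^ 'd) set"
  assumes "finite B"
  shows "card {x\<in>B. x + (z + w) \<notin> B} \<le> card {x\<in>B. x + z \<notin> B} + card {x\<in>B. x + w \<notin> B}"
proof -
  have "{x\<in>B. x + (z + w) \<notin> B} \<subseteq> {x\<in>B. x + z \<notin> B} \<union> (\<lambda>x. x - z) ` {x\<in>B. x + w \<notin> B}"
  proof
    fix x assume x: "x \<in> {x\<in>B. x + (z + w) \<notin> B}"
    show "x \<in> {x\<in>B. x + z \<notin> B} \<union> (\<lambda>x. x - z) ` {x\<in>B. x + w \<notin> B}"
    proof (cases "x + z \<in> B")
      case True
      then have "x + z \<in> {x\<in>B. x + w \<notin> B}" using x by (simp add: add.assoc)
      then have "(x + z) - z \<in> (\<lambda>x. x - z) ` {x\<in>B. x + w \<notin> B}" by (rule imageI)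
      then show ?thesis by simp
    qed (use x in auto)
  qed
  then have "card {x\<in>B. x + (z + w) \<notin> B}
      \<le> card ({x\<in>B. x + z \<notin> B} \<union> (\<lambda>x. x - z) ` {x\<in>B. x + w \<notin> B})"
    using assms by (intro card_mono) auto
  also have "\<dots> \<le> card {x\<in>B. x + z \<notin> B} + card ((\<lambda>x. x - z) ` {x\<in>B. x + w \<notin> B})"
    by (rule card_Un_le)
  also have "card ((\<lambda>x. x - z) ` {x\<in>B. x + w \<notin> B}) \<le> card {x\<in>B. x + w \<notin> B}"
    using assms by (intro card_image_le) auto
  finally show ?thesis by simp
qed

lemma card_moved_out_axis:
  fixes B :: "(int ^ 'd) set"
  assumes "finite B"
  shows "card {x\<in>B. x + axis i (int k) \<notin> B} \<le> k * card {x\<in>B. x + axis i 1 \<notin> B}"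
proof (induction k)
  case 0
  have "axis i (int 0) = (0 :: int ^ 'd)" by (simp add: vec_eq_iff axis_def)
  then show ?case by (simp only:) simp
next
  case (Suc k)
  have "axis i (int (Suc k)) = axis i (int k) + (axis i 1 :: int ^ 'd)"
    by (simp add: vec_eq_iff axis_def)
  then show ?case
    using card_moved_out_add[OF assms, of "axis i (int k)" "axis i 1"] Suc.IH by simp
qed

lemma card_moved_out_sum:
  fixes B :: "(int ^ 'd) set"
  assumes "finite B" "finite I"
  shows "card {x\<in>B. x + (\<Sum>i\<in>I. v i) \<notin> B} \<le> (\<Sum>i\<in>I. card {x\<in>B. x + v i \<notin> B})"
  using assms(2)
proof (induction I)
  case (insert j I)
  then show ?case
    using card_moved_out_add[OF assms(1), of "v j" "sum v I"] by simp
qed simp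

lemma vec_eq_sum_axis: "(z :: int ^ 'd) = (\<Sum>i\<in>UNIV. axis i (z $ i))"
  by (simp add: vec_eq_iff axis_def sum.delta)

lemma sum_card_moved_out_le_edge_boundary:
  fixes B :: "(int ^ 'd) set"
  assumes "finite B"
  shows "(\<Sum>i\<in>UNIV. card {x\<in>B. x + axis i 1 \<notin> B}) \<le> card (edge_boundary B)"
proof -
  have "(\<Sum>i\<in>(UNIV :: 'd set). card {x\<in>B. x + axis i 1 \<notin> B})
      = card (SIGMA i : (UNIV :: 'd set). {x\<in>B. x + axis i 1 \<notin> B})"
    using assms by (subst card_SigmaI) auto
  also have "\<dots> \<le> card (edge_boundary B)"
  proof (rule card_inj_on_le)
    show "inj_on (\<lambda>(i, x). (x, axis i (1 :: int))) (SIGMA i : (UNIV :: 'd set). {x\<in>B. x + axis i 1 \<notin> B})"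
      by (auto simp: inj_on_def axis_eq_axis)
    show "(\<lambda>(i, x). (x, axis i (1 :: int))) ` (SIGMA i : (UNIV :: 'd set). {x\<in>B. x + axis i 1 \<notin> B})
        \<subseteq> edge_boundary B"
      by (auto simp: edge_boundary_def unit_steps_def)
  qed (rule finite_edge_boundary[OF assms])
  finally show ?thesis .
qed

text \<open>Coordinates are nonnegative, so each translation in the cube is a composition of fewer
  than \<open>n\<close> positive unit steps along each axis.\<close>

definition corner_cube :: "nat \<Rightarrow> (int ^ 'd) set" where
  "corner_cube n = {z. \<forall>i. z $ i \<in> {0..<int n}}"

lemma corner_cube_eq:
  "(corner_cube n :: (int ^ 'd) set) = vec_lambda ` (UNIV \<rightarrow>\<^sub>E {0..<int n})"
proof
  show "(corner_cube n :: (int ^ 'd) set) \<subseteq> vec_lambda ` (UNIV \<rightarrow>\<^sub>E {0..<int n})"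
  proof
    fix z :: "int ^ 'd" assume "z \<in> corner_cube n"
    then have "vec_nth z \<in> UNIV \<rightarrow>\<^sub>E {0..<int n}"
      by (simp add: corner_cube_def PiE_def Pi_def)
    then have "vec_lambda (vec_nth z) \<in> vec_lambda ` (UNIV \<rightarrow>\<^sub>E {0..<int n})"
      by (rule imageI)
    then show "z \<in> vec_lambda ` (UNIV \<rightarrow>\<^sub>E {0..<int n})" by simp
  qed
next
  show "vec_lambda ` (UNIV \<rightarrow>\<^sub>E {0..<int n}) \<subseteq> (corner_cube n :: (int ^ 'd) set)"
    by (auto simp: corner_cube_def PiE_def Pi_def)
qed

lemma card_corner_cube: "card (corner_cube n :: (int ^ 'd) set) = n ^ CARD('d)"
proof -
  have "inj (vec_lambda :: ('d \<Rightarrow> int) \<Rightarrow> int ^ 'd)"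
    by (auto simp: inj_def vec_lambda_inject)
  then have "card (corner_cube n :: (int ^ 'd) set) = card ((UNIV :: 'd set) \<rightarrow>\<^sub>E {0..<int n})"
    unfolding corner_cube_eq by (intro card_image) (auto intro: inj_on_subset)
  then show ?thesis by (simp add: card_PiE)
qed

lemma finite_corner_cube: "finite (corner_cube n :: (int ^ 'd) set)"
  unfolding corner_cube_eq by (intro finite_imageI finite_PiE) auto

text \<open>
  Averaging over the cube of translations: at most \<open>card B\<close> of them take a given point of \<open>B\<close>
  back into \<open>B\<close>, while a translation moves at most \<open>n * card (edge_boundary B)\<close> points out.
\<close>

lemma edge_isoperimetry:
  fixes B :: "(int ^ 'd) set"
  assumes B: "finite B" and n: "2 * card B \<le> n ^ CARD('d)" "0 < n"
  shows "card B \<le> 2 * n * card (edge_boundary B)"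
proof -
  let ?Q = "corner_cube n :: (int ^ 'd) set"
  have out: "card {x\<in>B. x + z \<notin> B} \<le> n * card (edge_boundary B)" if z: "z \<in> ?Q" for z
  proof -
    have "card {x\<in>B. x + z \<notin> B} \<le> (\<Sum>i\<in>UNIV. card {x\<in>B. x + axis i (z $ i) \<notin> B})"
      using card_moved_out_sum[OF B, of UNIV "\<lambda>i. axis i (z $ i)"] by (simp flip: vec_eq_sum_axis)
    also have "\<dots> \<le> (\<Sum>i\<in>UNIV. n * card {x\<in>B. x + axis i 1 \<notin> B})"
    proof (rule sum_mono)
      fix i
      have "0 \<le> z $ i" "z $ i < int n" using z by (auto simp: corner_cube_def)
      then obtain k where k: "z $ i = int k" "k \<le> n" by (metis less_imp_le of_nat_less_iff nonneg_int_cases)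
      have "card {x\<in>B. x + axis i (z $ i) \<notin> B} \<le> k * card {x\<in>B. x + axis i 1 \<notin> B}"
        unfolding k(1) by (rule card_moved_out_axis[OF B])
      also have "\<dots> \<le> n * card {x\<in>B. x + axis i 1 \<notin> B}"
        using k(2) by (rule mult_le_mono1)
      finally show "card {x\<in>B. x + axis i (z $ i) \<notin> B} \<le> n * card {x\<in>B. x + axis i 1 \<notin> B}" .
    qed
    also have "\<dots> \<le> n * card (edge_boundary B)"
      using sum_card_moved_out_le_edge_boundary[OF B] by (simp flip: sum_distrib_left)
    finally show ?thesis .
  qed
  have count: "card {y\<in>S. P y} = (\<Sum>y\<in>S. if P y then 1 else 0)"
    if "finite S" for S :: "(int ^ 'd) set" and P
    using that by (simp flip: sum.inter_filter)
  have "(\<Sum>z\<in>?Q. card {x\<in>B. x + z \<in> B}) = (\<Sum>x\<in>B. card {z\<in>?Q. x + z \<in> B})"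
    by (simp only: count[OF B] count[OF finite_corner_cube]) (rule sum.swap)
  also have "\<dots> \<le> (\<Sum>x\<in>B. card B)"
  proof (rule sum_mono)
    fix x show "card {z\<in>?Q. x + z \<in> B} \<le> card B"
      using B by (intro card_inj_on_le[where f = "\<lambda>z. x + z"]) (auto simp: inj_on_def)
  qed
  finally have "(\<Sum>z\<in>?Q. card {x\<in>B. x + z \<in> B}) \<le> card B * card B" by simp
  moreover have "card B = card {x\<in>B. x + z \<in> B} + card {x\<in>B. x + z \<notin> B}" for z
    using B by (subst card_Un_disjoint[symmetric]) (auto intro: arg_cong[where f=card])
  then have "(\<Sum>z\<in>?Q. card B) = (\<Sum>z\<in>?Q. card {x\<in>B. x + z \<in> B}) + (\<Sum>z\<in>?Q. card {x\<in>B. x + z \<notin> B})"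
    by (simp flip: sum.distrib)
  moreover have "(\<Sum>z\<in>?Q. card {x\<in>B. x + z \<notin> B}) \<le> (\<Sum>z\<in>?Q. n * card (edge_boundary B))"
    by (rule sum_mono) (rule out)
  ultimately have "n ^ CARD('d) * card B \<le> card B * card B + n ^ CARD('d) * (n * card (edge_boundary B))"
    by (simp add: card_corner_cube)
  \<comment> \<open>With at least \<open>2 * card B\<close> translations, the quadratic term is at
    most half of the left-hand side and can be absorbed.\<close>
  moreover have "2 * (card B * card B) \<le> n ^ CARD('d) * card B"
    using n(1) by (metis mult.assoc mult_le_mono1)
  ultimately have "n ^ CARD('d) * card B \<le> 2 * (n ^ CARD('d) * (n * card (edge_boundary B)))"
    by linarith
  then have "n ^ CARD('d) * card B \<le> n ^ CARD('d) * (2 * n * card (edge_boundary B))"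
    by (simp only: mult.left_commute mult.assoc)
  then show ?thesis using n(2) by simp
qed

text \<open>The mean of \<open>min n \<tau>\<close> for the walk from \<open>x\<close>, where \<open>\<tau>\<close> is its exit time from \<open>B\<close>.\<close>

primrec mean_exit_time :: "(int ^ 'd) set \<Rightarrow> nat \<Rightarrow> int ^ 'd \<Rightarrow> real" where
  "mean_exit_time B 0 x = 0"
| "mean_exit_time B (Suc n) x = (if x \<in> B then 1 + avg (mean_exit_time B n) x else 0)"

section \<open>Mean exit times from small sets\<close>

lemma mean_exit_time_nonneg: "0 \<le> mean_exit_time B n x"
proof (induction n arbitrary: x)
  case (Suc n)
  have "0 \<le> avg (mean_exit_time B n) x" by (rule avg_nonneg) (rule Suc)
  then show ?case by simp
qed simp

lemma mean_exit_time_outside: "x \<notin> B \<Longrightarrow> mean_exit_time B n x = 0"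
  by (cases n) auto

text \<open>Inserted into the recursion, this gives \<open>f x - avg f x \<le> 1\<close> on
  \<open>B\<close> for \<open>f = mean_exit_time B t\<close>, as \<open>superlevel_growth\<close>
  requires.\<close>

lemma mean_exit_time_Suc_mono: "mean_exit_time B n x \<le> mean_exit_time B (Suc n) x"
proof (induction n arbitrary: x)
  case 0
  show ?case using mean_exit_time_nonneg[of B 1 x] by simp
next
  case (Suc n)
  then show ?case by (auto intro: avg_mono)
qed

text \<open>A discrete Green formula: edges with both ends in \<open>B\<close> occur in both
  orientations with opposite signs and cancel, which leaves the flux through the boundary.\<close>

lemma sum_laplacian_superlevel:
  fixes f :: "int ^ 'd \<Rightarrow> real" and B :: "(int ^ 'd) set"
  assumes "finite B"
  shows "(\<Sum>x\<in>B. f x - avg f x) * real (card (unit_steps :: (int ^ 'd) set))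
    = (\<Sum>(x, e)\<in>edge_boundary B. f x - f (x + e))"
proof -
  let ?U = "unit_steps :: (int ^ 'd) set"
  let ?g = "\<lambda>(x, e). f x - f (x + e)"
  define I where "I = {(x, e). x \<in> B \<and> e \<in> ?U \<and> x + e \<in> B}"
  have fin: "finite I"
    by (rule finite_subset[of _ "B \<times> ?U"]) (auto simp: I_def assms finite_unit_steps)
  have neg: "- e \<in> ?U" if "e \<in> ?U" for e
    using that uminus_unit_steps by blast
  have "(\<Sum>p\<in>I. ?g p) = (\<Sum>p\<in>I. - ?g p)"
    by (rule sum.reindex_bij_witness[where i = "\<lambda>(x, e). (x + e, - e)" and j = "\<lambda>(x, e). (x + e, - e)"])
      (auto simp: I_def neg)
  then have zero: "(\<Sum>p\<in>I. ?g p) = 0"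
    by (simp add: sum_negf)
  have "(\<Sum>x\<in>B. f x - avg f x) * real (card ?U) = (\<Sum>x\<in>B. \<Sum>e\<in>?U. f x - f (x + e))"
    unfolding sum_distrib_right using card_unit_steps_pos[where 'd='d]
    by (intro sum.cong refl) (simp add: avg_def sum_subtractf left_diff_distrib)
  also have "\<dots> = (\<Sum>p\<in>B \<times> ?U. ?g p)"
    by (simp add: sum.cartesian_product)
  also have "B \<times> ?U = I \<union> edge_boundary B"
    by (auto simp: I_def edge_boundary_def)
  also have "(\<Sum>p\<in>I \<union> edge_boundary B. ?g p) = (\<Sum>p\<in>I. ?g p) + (\<Sum>p\<in>edge_boundary B. ?g p)"
    by (rule sum.union_disjoint) (auto simp: fin finite_edge_boundary assms, auto simp: I_def edge_boundary_def)
  finally show ?thesis using zero by simp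
qed

text \<open>
  The flux out of a superlevel set is at most its volume, so that most boundary edges
  lead to points where \<open>f\<close> is almost as large.
\<close>

lemma superlevel_growth:
  fixes f :: "int ^ 'd \<Rightarrow> real"
  defines "c \<equiv> real (card (unit_steps :: (int ^ 'd) set))"
  assumes fin: "finite {x. s - 4 * c * real n < f x}"
    and sub: "\<And>x. s < f x \<Longrightarrow> f x - avg f x \<le> 1"
    and n: "2 * card {x. s < f x} \<le> n ^ CARD('d)" "0 < n"
  shows "real (card {x. s < f x}) * (1 + 1 / (4 * c * real n))
    \<le> real (card {x. s - 4 * c * real n < f x})"
proof -
  let ?U = "unit_steps :: (int ^ 'd) set"
  define g where "g = 4 * c * real n"
  define B where "B = {x. s < f x}"
  define Y where "Y = {x. s - g < f x \<and> f x \<le> s}"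
  have c: "c > 0" unfolding c_def using card_unit_steps_pos by simp
  have g: "g > 0" using c n(2) by (simp add: g_def)
  have finB: "finite B" and finY: "finite Y"
    using g fin by (auto simp: B_def Y_def g_def[symmetric] intro: rev_finite_subset)
  \<comment> \<open>Boundary edges that end above the level \<open>s - g\<close>; along every other
    boundary edge \<open>f\<close> drops by at least \<open>g\<close>, and the flux bound allows few
    of these.\<close>
  define E where "E = {p \<in> edge_boundary B. fst p + snd p \<in> Y}"
  have finE: "finite E" "finite (edge_boundary B)"
    using finite_edge_boundary[OF finB] by (auto simp: E_def)
  have "real (card E) \<le> c * real (card Y)"
  proof -
    have "card E \<le> card (Y \<times> ?U)"
    proof (rule card_inj_on_le[where f = "\<lambda>p. (fst p + snd p, snd p)"])
      show "inj_on (\<lambda>p. (fst p + snd p, snd p)) E"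
        by (auto simp: inj_on_def prod_eq_iff)
      show "(\<lambda>p. (fst p + snd p, snd p)) ` E \<subseteq> Y \<times> ?U"
        by (auto simp: E_def edge_boundary_def)
    qed (use finY finite_unit_steps in auto)
    then have "real (card E) \<le> real (card Y * card ?U)"
      unfolding card_cartesian_product by (rule of_nat_mono)
    then show ?thesis by (simp add: c_def mult.commute)
  qed
  moreover have "g * (real (card (edge_boundary B)) - real (card E)) \<le> c * real (card B)"
  proof -
    have "g * (real (card (edge_boundary B)) - real (card E)) = (\<Sum>p\<in>edge_boundary B - E. g)"
      using finE by (subst sum_constant, subst card_Diff_subset)
        (auto simp: E_def card_mono of_nat_diff intro!: card_mono)
    also have "\<dots> \<le> (\<Sum>p\<in>edge_boundary B - E. case p of (x, e) \<Rightarrow> f x - f (x + e))"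
      by (rule sum_mono) (auto simp: E_def edge_boundary_def B_def Y_def)
    also have "\<dots> \<le> (\<Sum>p\<in>edge_boundary B. case p of (x, e) \<Rightarrow> f x - f (x + e))"
      by (rule sum_mono2) (use finE in \<open>auto simp: edge_boundary_def B_def\<close>)
    also have "\<dots> = (\<Sum>x\<in>B. f x - avg f x) * c"
      unfolding c_def by (rule sum_laplacian_superlevel[OF finB, symmetric])
    also have "\<dots> \<le> (\<Sum>x\<in>B. 1) * c"
      using c sub by (intro mult_right_mono sum_mono) (auto simp: B_def)
    finally show ?thesis by (simp add: mult.commute)
  qed
  ultimately have "g * real (card (edge_boundary B)) \<le> c * real (card B) + g * (c * real (card Y))"
  proof -
    assume "real (card E) \<le> c * real (card Y)"
    then have "g * real (card E) \<le> g * (c * real (card Y))" using g by (intro mult_left_mono) auto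
    moreover assume "g * (real (card (edge_boundary B)) - real (card E)) \<le> c * real (card B)"
    ultimately show ?thesis by (simp add: right_diff_distrib)
  qed
  moreover have "real (card B) \<le> 2 * real n * real (card (edge_boundary B))"
  proof -
    have "card B \<le> 2 * n * card (edge_boundary B)"
      by (rule edge_isoperimetry[OF finB]) (use n in \<open>auto simp: B_def\<close>)
    then have "real (card B) \<le> real (2 * n * card (edge_boundary B))" by (simp only: of_nat_le_iff)
    then show ?thesis by simp
  qed
  \<comment> \<open>The choice \<open>g = 4 * c * n\<close> makes the boundary term at least twice
    the flux bound \<open>c * card B\<close>, so that half of it must come from
    \<open>Y\<close>.\<close>
  then have "2 * c * real (card B) \<le> g * real (card (edge_boundary B))"
    using mult_left_mono[of "real (card B)" _ "2 * c"] c by (simp add: g_def algebra_simps)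
  ultimately have "c * real (card B) \<le> c * (g * real (card Y))"
    by (simp add: algebra_simps)
  then have "real (card B) \<le> g * real (card Y)" using c by simp
  then have "real (card B) / g \<le> real (card Y)" using g by (simp add: field_simps)
  moreover have "card {x. s - g < f x} = card B + card Y"
    using finB finY g by (subst card_Un_disjoint[symmetric])
      (auto simp: B_def Y_def intro!: arg_cong[where f=card])
  ultimately have "real (card B) * (1 + 1 / g) \<le> real (card {x. s - g < f x})"
    by (simp add: distrib_left)
  then show ?thesis unfolding B_def g_def .
qed

text \<open>The total drop \<open>k * g\<close> of the next lemma divided by \<open>4 ^ l\<close>:
  there are \<open>4 * n * c * 2 ^ d\<close> rounds of drop \<open>4 * c * n\<close>, with
  \<open>n = 4 * 2 ^ l\<close>.\<close>

definition exit_const :: "nat \<Rightarrow> nat \<Rightarrow> real" where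
  "exit_const c d = 256 * (real c)\<^sup>2 * 2 ^ d"

text \<open>
  With \<open>n = 2 ^ (l + 2)\<close> the volume is multiplied by \<open>2 ^ d\<close> after at most \<open>4 * n * c * 2 ^ d\<close> of the
  steps in \<open>superlevel_growth\<close>, each of which lowers the level by \<open>4 * c * n\<close>.
\<close>

lemma mean_exit_time_superlevel_growth:
  fixes B :: "(int ^ 'd) set"
  defines "c \<equiv> card (unit_steps :: (int ^ 'd) set)"
  assumes B: "finite B"
    and V: "2 ^ (CARD('d) * l) \<le> card {x. s < mean_exit_time B t x}"
    and s: "exit_const c CARD('d) * 4 ^ l \<le> s"
  shows "2 ^ (CARD('d) * Suc l) \<le> card {x. s - exit_const c CARD('d) * 4 ^ l < mean_exit_time B t x}"
proof (rule ccontr)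
  let ?f = "mean_exit_time B t" and ?d = "CARD('d)"
  define n :: nat where "n = 2 ^ (l + 2)"
  define g where "g = 4 * real c * real n"
  define k :: nat where "k = 4 * n * c * 2 ^ ?d"
  define V where "V u = card {x. u < ?f x}" for u
  have c: "c > 0" unfolding c_def by (rule card_unit_steps_pos)
  have n: "n > 0" and g: "g > 0" using c by (auto simp: n_def g_def)
  have kg: "real k * g = exit_const c ?d * 4 ^ l"
  proof -
    have "(4::real) ^ l = 2 ^ l * 2 ^ l" by (simp flip: power_mult_distrib)
    then show ?thesis by (simp add: k_def g_def n_def exit_const_def power2_eq_square)
  qed
  have fin: "finite {x. u < ?f x}" if "u \<ge> 0" for u
  proof (rule finite_subset[OF _ B])
    show "{x. u < ?f x} \<subseteq> B"
    proof
      fix x assume "x \<in> {x. u < ?f x}"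
      then show "x \<in> B" using that mean_exit_time_outside[of x B t] by (cases "x \<in> B") auto
    qed
  qed
  have sub: "?f x - avg ?f x \<le> 1" if "u \<ge> 0" "u < ?f x" for u x
  proof -
    have "x \<in> B" using that mean_exit_time_outside[of x B t] by (cases "x \<in> B") auto
    then show ?thesis using mean_exit_time_Suc_mono[of B t x] by simp
  qed
  assume "\<not> 2 ^ (?d * Suc l) \<le> card {x. s - exit_const c ?d * 4 ^ l < ?f x}"
  then have small: "V (s - real k * g) < 2 ^ (?d * Suc l)"
    by (simp add: V_def kg)
  have pos: "0 \<le> s - real j * g" if "j \<le> k" for j
    using that g s kg mult_right_mono[of "real j" "real k" g] by simp
  \<comment> \<open>As the volume is assumed to stay below \<open>2 ^ (d * (l + 1))\<close>, one and
    the same \<open>n\<close> meets the isoperimetric hypothesis in all \<open>k\<close>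
    rounds.\<close>
  have bound: "V (s - real j * g) < 2 ^ (?d * Suc l)" if "j \<le> k" for j
  proof -
    have "V (s - real j * g) \<le> V (s - real k * g)"
      unfolding V_def
    proof (intro card_mono fin pos Collect_mono impI)
      fix x assume "s - real j * g < ?f x"
      moreover have "real j * g \<le> real k * g" using that g by (intro mult_right_mono) auto
      ultimately show "s - real k * g < ?f x" by linarith
    qed simp
    then show ?thesis using small by simp
  qed
  \<comment> \<open>Each round adds at least \<open>V s / g\<close>, so \<open>k\<close> rounds
    multiply the volume by at least \<open>1 + k / g = 1 + 2 ^ d\<close>.\<close>
  have grow: "real (V s) * (1 + real j / g) \<le> real (V (s - real j * g))" if "j \<le> k" for j
    using that
  proof (induction j)
    case (Suc j)
    let ?u = "s - real j * g"
    have u: "?u - g = s - real (Suc j) * g" by (simp add: algebra_simps)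
    have "real (V ?u) * (1 + 1 / g) \<le> real (V (?u - g))"
      unfolding V_def g_def c_def
    proof (rule superlevel_growth)
      show "finite {x. s - real j * (4 * real (card (unit_steps :: (int ^ 'd) set)) * real n)
         - 4 * real (card (unit_steps :: (int ^ 'd) set)) * real n < ?f x}"
        using fin[of "?u - g"] pos[of "Suc j"] Suc.prems u by (simp add: g_def c_def)
      show "?f x - avg ?f x \<le> 1"
        if "s - real j * (4 * real (card (unit_steps :: (int ^ 'd) set)) * real n) < ?f x" for x
        using sub[of ?u x] pos[of j] Suc.prems that by (simp add: g_def c_def)
      have "2 * 2 ^ (?d * Suc l) \<le> n ^ ?d"
      proof -
        have "Suc (?d * Suc l) \<le> (l + 2) * ?d"
          using zero_less_card_finite[where 'a='d] by (simp add: algebra_simps)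
        then have "(2::nat) ^ Suc (?d * Suc l) \<le> 2 ^ ((l + 2) * ?d)"
          by (rule power_increasing) simp
        then show ?thesis by (simp only: n_def power_mult power_Suc)
      qed
      then show "2 * card {x. s - real j * (4 * real (card (unit_steps :: (int ^ 'd) set)) * real n) < ?f x} \<le> n ^ ?d"
        using bound[of j] Suc.prems by (simp add: V_def g_def c_def)
    qed (rule n)
    moreover have "real (V s) \<le> real (V ?u)"
      unfolding V_def
    proof (intro of_nat_mono card_mono fin Collect_mono impI)
      fix x assume "s < ?f x"
      moreover have "0 \<le> real j * g" using g by simp
      ultimately show "s - real j * g < ?f x" by linarith
    qed (use pos[of j] Suc.prems in simp)
    then have "real (V s) / g \<le> real (V ?u) / g" using g by (simp add: divide_right_mono)
    moreover have "real (V s) * (1 + real j / g) \<le> real (V ?u)" using Suc by simp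
    ultimately have "real (V s) * (1 + real j / g) + real (V s) / g \<le> real (V (?u - g))"
      by (simp add: algebra_simps)
    then show ?case by (simp add: u add_divide_distrib algebra_simps)
  qed simp
  have "real k / g = 2 ^ ?d"
    using c n by (simp add: k_def g_def field_simps)
  then have "real (V s) * (1 + 2 ^ ?d) \<le> real (V (s - real k * g))"
    using grow[of k] by simp
  also have "\<dots> < 2 ^ (?d * Suc l)"
    using small by (metis of_nat_less_iff of_nat_numeral of_nat_power)
  finally have "real (V s) * (1 + 2 ^ ?d) < 2 ^ (?d * l) * 2 ^ ?d"
    by (simp add: power_add algebra_simps)
  moreover have "(2::real) ^ (?d * l) \<le> real (V s)"
    using V unfolding V_def by (metis of_nat_le_iff of_nat_numeral of_nat_power)
  then have "2 ^ (?d * l) * (1 + 2 ^ ?d) \<le> real (V s) * (1 + 2 ^ ?d)"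
    by (intro mult_right_mono) auto
  ultimately have "(2::real) ^ (?d * l) * (1 + 2 ^ ?d) < 2 ^ (?d * l) * 2 ^ ?d" by linarith
  then show False by (simp add: algebra_simps)
qed

text \<open>Were the bound exceeded, the superlevel set at height \<open>?K * 4 ^ i\<close> would be
  nonempty, and lowering the level by \<open>?K * 4 ^ l\<close> for each \<open>l < i\<close> would
  bring its volume to \<open>2 ^ (d * i)\<close>. The drops sum to at most
  \<open>?K * 4 ^ i\<close>, so that set still lies in \<open>B\<close>, which is too small.\<close>

lemma mean_exit_time_le:
  fixes B :: "(int ^ 'd) set"
  assumes B: "finite B" and V: "card B < 2 ^ (CARD('d) * i)"
  shows "mean_exit_time B t x \<le> exit_const (card (unit_steps :: (int ^ 'd) set)) CARD('d) * 4 ^ i"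
proof (rule ccontr)
  let ?K = "exit_const (card (unit_steps :: (int ^ 'd) set)) CARD('d)"
  define D where "D l = ?K * (\<Sum>j<l. 4 ^ j)" for l
  have K: "?K > 0" using card_unit_steps_pos[where 'd='d] by (simp add: exit_const_def)
  have geo: "3 * (\<Sum>j<l. (4::real) ^ j) = 4 ^ l - 1" for l
    by (induction l) auto
  assume "\<not> mean_exit_time B t x \<le> ?K * 4 ^ i"
  then have x: "?K * 4 ^ i < mean_exit_time B t x" by simp
  have "2 ^ (CARD('d) * l) \<le> card {x. ?K * 4 ^ i - D l < mean_exit_time B t x}" if "l \<le> i" for l
    using that
  proof (induction l)
    case 0
    have "{x. ?K * 4 ^ i < mean_exit_time B t x} \<subseteq> B"
      using mean_exit_time_outside[of _ B t] K by (force simp: not_less mult_less_0_iff intro: ccontr)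
    then have "finite {x. ?K * 4 ^ i < mean_exit_time B t x}" by (rule finite_subset[OF _ B])
    then have "card {x. ?K * 4 ^ i < mean_exit_time B t x} > 0" using x by (auto simp: card_gt_0_iff)
    then show ?case by (simp add: D_def)
  next
    case (Suc l)
    have "D (Suc l) \<le> ?K * 4 ^ i"
      unfolding D_def
    proof (rule mult_left_mono)
      have "(4::real) ^ Suc l \<le> 4 ^ i" using Suc.prems by (intro power_increasing) auto
      moreover have "(0::real) \<le> 4 ^ i" by simp
      ultimately show "(\<Sum>j<Suc l. (4::real) ^ j) \<le> 4 ^ i" using geo[of "Suc l"] by linarith
    qed (use K in simp)
    then have "?K * 4 ^ l \<le> ?K * 4 ^ i - D l"
      by (simp add: D_def algebra_simps)
    from mean_exit_time_superlevel_growth[OF B _ this] Suc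
    show ?case by (simp add: D_def algebra_simps)
  qed
  from this[of i] have *: "2 ^ (CARD('d) * i) \<le> card {x. ?K * 4 ^ i - D i < mean_exit_time B t x}" by simp
  have "D i \<le> ?K * 4 ^ i"
    unfolding D_def
  proof (rule mult_left_mono)
    have "(0::real) \<le> 4 ^ i" by simp
    then show "(\<Sum>j<i. (4::real) ^ j) \<le> 4 ^ i" using geo[of i] by linarith
  qed (use K in simp)
  then have "{x. ?K * 4 ^ i - D i < mean_exit_time B t x} \<subseteq> B"
    using mean_exit_time_outside[of _ B t] by (force intro: ccontr)
  then have "card {x. ?K * 4 ^ i - D i < mean_exit_time B t x} \<le> card B"
    by (rule card_mono[OF B])
  then show False using * V by simp
qed

section \<open>Crossing shells in which the cluster is thin\<close>

text \<open>
  The mean of \<open>\<phi>\<close> at the exit point from \<open>A\<close> of the walk from \<open>x\<close>, restricted to the event that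
  this exit happens within \<open>n\<close> steps.
\<close>

primrec exit_mean :: "(int ^ 'd) set \<Rightarrow> (int ^ 'd \<Rightarrow> real) \<Rightarrow> nat \<Rightarrow> int ^ 'd \<Rightarrow> real" where
  "exit_mean A \<phi> 0 x = (if x \<in> A then 0 else \<phi> x)"
| "exit_mean A \<phi> (Suc n) x = (if x \<in> A then avg (exit_mean A \<phi> n) x else \<phi> x)"

lemma exit_mean_outside: "x \<notin> A \<Longrightarrow> exit_mean A \<phi> n x = \<phi> x"
  by (cases n) auto

lemma exit_mean_nonneg:
  assumes "\<And>x. 0 \<le> \<phi> x"
  shows "0 \<le> exit_mean A \<phi> n x"
proof (induction n arbitrary: x)
  case (Suc n)
  have "0 \<le> avg (exit_mean A \<phi> n) x" by (rule avg_nonneg) (rule Suc)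
  then show ?case using assms by simp
qed (use assms in simp)

lemma exit_mean_le:
  assumes "\<And>x. \<phi> x \<le> c" "0 \<le> c"
  shows "exit_mean A \<phi> n x \<le> c"
proof (induction n arbitrary: x)
  case (Suc n)
  have "avg (exit_mean A \<phi> n) x \<le> c" by (rule avg_le) (rule Suc)
  then show ?case using assms by simp
qed (use assms in simp)

lemma exit_mean_add: "exit_mean A (\<lambda>x. \<phi> x + \<psi> x) n x = exit_mean A \<phi> n x + exit_mean A \<psi> n x"
proof (induction n arbitrary: x)
  case (Suc n)
  have "exit_mean A (\<lambda>x. \<phi> x + \<psi> x) n = (\<lambda>x. exit_mean A \<phi> n x + exit_mean A \<psi> n x)"
    using Suc by blast
  then show ?case by (simp add: avg_add)
qed simp

lemma exit_mean_cmult: "exit_mean A (\<lambda>x. c * \<phi> x) n x = c * exit_mean A \<phi> n x"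
proof (induction n arbitrary: x)
  case (Suc n)
  have "exit_mean A (\<lambda>x. c * \<phi> x) n = (\<lambda>x. c * exit_mean A \<phi> n x)"
    using Suc by blast
  then show ?case by (simp add: avg_cmult)
qed simp

lemma exit_mean_zero: "exit_mean A (\<lambda>_. 0) n x = 0"
  using exit_mean_cmult[of A 0 "\<lambda>_. 0" n x] by simp

lemma exit_mean_sum:
  "finite J \<Longrightarrow> exit_mean A (\<lambda>x. \<Sum>j\<in>J. \<phi> j x) n x = (\<Sum>j\<in>J. exit_mean A (\<phi> j) n x)"
  by (induction J rule: finite_induct) (simp_all add: exit_mean_add exit_mean_zero)

text \<open>The middle sphere is \<open>a * 2 ^ i\<close> away from both sides. Fewer than
  \<open>2 ^ (d * i)\<close> cluster points keep mean exit times of order \<open>4 ^ i\<close>,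
  which a large \<open>a\<close> makes small against \<open>(a * 2 ^ i) ^ 2\<close>.\<close>

definition good_shell :: "nat \<Rightarrow> (int ^ 'd) set \<Rightarrow> nat \<Rightarrow> nat \<Rightarrow> bool" where
  "good_shell a A s i \<longleftrightarrow>
    card {x\<in>A. s \<le> sup_norm x \<and> sup_norm x < s + 2 * a * 2 ^ i} < 2 ^ (CARD('d) * i)"

text \<open>
  In the cube of radius \<open>m\<close> around a point of the middle of the shell, the mean of \<open>\<phi>\<close> at the exit
  from \<open>A\<close> is compared with \<open>M * (sq_norm (x - y) + mean_exit_time B n x) / m\<^sup>2\<close>, which is harmonic in the
  part \<open>B\<close> of \<open>A\<close> inside this cube.
\<close>

lemma exit_mean_good_shell:
  fixes A :: "(int ^ 'd) set"
  assumes A: "finite A" and a: "0 < a" "4 * exit_const (card (unit_steps :: (int ^ 'd) set)) CARD('d) \<le> (real a)\<^sup>2"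
    and good: "good_shell a A u i"
    and \<phi>: "\<And>x. u \<le> sup_norm x \<Longrightarrow> \<phi> x = 0" and M: "0 \<le> M"
    and bound: "\<And>n x. u \<le> sup_norm x \<Longrightarrow> exit_mean A \<phi> n x \<le> M"
    and x: "u + 2 * a * 2 ^ i \<le> sup_norm x"
  shows "exit_mean A \<phi> n x \<le> M / 4"
proof -
  let ?K = "exit_const (card (unit_steps :: (int ^ 'd) set)) CARD('d)"
  define m where "m = a * 2 ^ i"
  have m: "0 < m" using a by (simp add: m_def)
  have mid: "exit_mean A \<phi> n y \<le> M / 4" if y: "sup_norm y = u + m" for n y
  proof -
    define B where "B = {x\<in>A. sup_norm (x - y) < m}"
    have inside: "u < sup_norm x \<and> sup_norm x < u + 2 * m" if "sup_norm (x - y) < m" for x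
      using that y sup_norm_le_add_diff[of x y] sup_norm_le_add_diff[of y x] sup_norm_minus_commute[of x y] by linarith
    have "B \<subseteq> {x\<in>A. u \<le> sup_norm x \<and> sup_norm x < u + 2 * a * 2 ^ i}"
      using inside by (auto simp: B_def m_def mult.assoc less_imp_le)
    then have "card B \<le> card {x\<in>A. u \<le> sup_norm x \<and> sup_norm x < u + 2 * a * 2 ^ i}"
      using A by (intro card_mono) auto
    also have "\<dots> < 2 ^ (CARD('d) * i)" using good by (simp add: good_shell_def)
    finally have "card B < 2 ^ (CARD('d) * i)" .
    then have exit: "mean_exit_time B n y \<le> ?K * 4 ^ i" for n
      using A by (intro mean_exit_time_le) (auto simp: B_def)
    have far: "exit_mean A \<phi> n x \<le> M / (real m)\<^sup>2 * (sq_norm (x - y) + mean_exit_time B n x)"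
      if "u \<le> sup_norm x" "m \<le> sup_norm (x - y)" for n x
    proof -
      have "(real m)\<^sup>2 \<le> (real (sup_norm (x - y)))\<^sup>2" using that(2) by simp
      also have "\<dots> \<le> sq_norm (x - y)" by (rule power2_sup_norm_le_sq_norm)
      finally have "(real m)\<^sup>2 \<le> sq_norm (x - y) + mean_exit_time B n x"
        using mean_exit_time_nonneg[of B n x] by linarith
      then have "M / (real m)\<^sup>2 * (real m)\<^sup>2 \<le> M / (real m)\<^sup>2 * (sq_norm (x - y) + mean_exit_time B n x)"
        using M by (intro mult_left_mono) auto
      then show ?thesis using bound[OF that(1), of n] m by simp
    qed
    have near: "exit_mean A \<phi> n x \<le> M / (real m)\<^sup>2 * (sq_norm (x - y) + mean_exit_time B n x)"
      if "sup_norm (x - y) < m" for x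
      using that
    proof (induction n arbitrary: x)
      case 0
      then show ?case
        using \<phi>[of x] inside[of x] M sq_norm_nonneg[of "x - y"] by simp
    next
      case (Suc n)
      show ?case
      proof (cases "x \<in> A")
        case True
        then have xB: "x \<in> B" using Suc.prems by (simp add: B_def)
        have "exit_mean A \<phi> (Suc n) x = avg (exit_mean A \<phi> n) x" using True by simp
        also have "\<dots> \<le> avg (\<lambda>x. M / (real m)\<^sup>2 * (sq_norm (x - y) + mean_exit_time B n x)) x"
        proof (rule avg_mono)
          fix e :: "int ^ 'd" assume e: "e \<in> unit_steps"
          have "u \<le> sup_norm (x + e)" using inside[OF Suc.prems] sup_norm_step(2)[OF e, of x] by linarith
          then show "exit_mean A \<phi> n (x + e) \<le> M / (real m)\<^sup>2 * (sq_norm (x + e - y) + mean_exit_time B n (x + e))"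
            using far[of "x + e"] Suc.IH[of "x + e"] by (cases "sup_norm (x + e - y) < m") auto
        qed
        also have "\<dots> = M / (real m)\<^sup>2 * (sq_norm (x - y) + mean_exit_time B (Suc n) x)"
          using xB by (simp only: avg_cmult avg_add avg_sq_norm mean_exit_time.simps if_True add.assoc)
        finally show ?thesis .
      next
        case False
        then have "exit_mean A \<phi> (Suc n) x = 0" using \<phi>[of x] inside[OF Suc.prems] by simp
        then show ?thesis
          using M sq_norm_nonneg[of "x - y"] mean_exit_time_nonneg[of B "Suc n" x] by simp
      qed
    qed
    have "exit_mean A \<phi> n y \<le> M / (real m)\<^sup>2 * (sq_norm (y - y) + mean_exit_time B n y)"
      using near[of y] m by simp
    also have "\<dots> \<le> M / (real m)\<^sup>2 * (?K * 4 ^ i)"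
      using exit M by (intro mult_left_mono) auto
    also have "\<dots> \<le> M / (real m)\<^sup>2 * ((real m)\<^sup>2 / 4)"
    proof (intro mult_left_mono)
      have "(real m)\<^sup>2 = (real a)\<^sup>2 * 4 ^ i"
        by (simp add: m_def power_mult_distrib) (simp add: power2_eq_square flip: power_mult_distrib)
      then show "?K * 4 ^ i \<le> (real m)\<^sup>2 / 4"
        using mult_right_mono[OF a(2), of "4 ^ i"] by simp
    qed (use M in auto)
    also have "\<dots> = M / 4" using m by simp
    finally show ?thesis .
  qed
  \<comment> \<open>From further out, a path that contributes must meet the middle sphere: no step
    jumps over it, and beyond it \<open>\<phi>\<close> vanishes.\<close>
  have "exit_mean A \<phi> n x \<le> M / 4" if "u + m \<le> sup_norm x" for n x
    using that
  proof (induction n arbitrary: x)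
    case 0
    then show ?case using \<phi>[of x] M by simp
  next
    case (Suc n)
    consider "sup_norm x = u + m" | "u + m < sup_norm x" "x \<in> A" | "x \<notin> A" using Suc.prems by linarith
    then show ?case
    proof cases
      case 1
      then show ?thesis by (rule mid)
    next
      case 2
      have "avg (exit_mean A \<phi> n) x \<le> M / 4"
      proof (rule avg_le)
        fix e :: "int ^ 'd" assume "e \<in> unit_steps"
        then show "exit_mean A \<phi> n (x + e) \<le> M / 4"
          using 2 sup_norm_step(2)[of e x] by (intro Suc.IH) linarith
      qed
      then show ?thesis using 2 by simp
    next
      case 3
      then show ?thesis using \<phi>[of x] M Suc.prems by simp
    qed
  qed
  moreover have "u + m \<le> sup_norm x" using x by (simp add: m_def mult.assoc)
  ultimately show ?thesis by blast
qed

text \<open>Disjoint good shells between the radii \<open>s\<close> and \<open>t\<close>, gaps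
  allowed. The rule adds the outermost shell, which an incoming walk crosses first; the estimate
  from \<open>u\<close> inward is then the induction hypothesis.\<close>

inductive shell_chain :: "nat \<Rightarrow> (int ^ 'd) set \<Rightarrow> nat \<Rightarrow> nat \<Rightarrow> nat \<Rightarrow> bool" for a A s where
  no_shell: "s \<le> t \<Longrightarrow> shell_chain a A s t 0"
| add_shell: "shell_chain a A s u j \<Longrightarrow> good_shell a A u i \<Longrightarrow> u + 2 * a * 2 ^ i \<le> t \<Longrightarrow>
    shell_chain a A s t (Suc j)"

lemma shell_chain_le: "shell_chain a A s t j \<Longrightarrow> s \<le> t"
  by (induction rule: shell_chain.induct) auto

lemma shell_chain_length:
  assumes "0 < a"
  shows "shell_chain a A s t j \<Longrightarrow> s + j \<le> t"
proof (induction rule: shell_chain.induct)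
  case (add_shell u j i t)
  have "1 \<le> 2 * a * 2 ^ i" using assms by simp
  then show ?case using add_shell by linarith
qed simp

lemma shell_chain_mono_top: "shell_chain a A s t j \<Longrightarrow> t \<le> t' \<Longrightarrow> shell_chain a A s t' j"
  by (induction rule: shell_chain.induct) (auto intro: shell_chain.intros)

lemma shell_chain_drop: "shell_chain a A s t (Suc j) \<Longrightarrow> shell_chain a A s t j"
  by (erule shell_chain.cases) (auto intro: shell_chain_mono_top)

lemma shell_chain_shorten:
  assumes "shell_chain a A s t j" "j' \<le> j"
  shows "shell_chain a A s t j'"
  using assms(2) by (induction rule: inc_induct) (auto intro: shell_chain_drop assms(1))

text \<open>The greedy choice of shells proceeds inward from radius \<open>R\<close>, against the
  direction of the inductive rule.\<close>

lemma shell_chain_add_inner: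
  "shell_chain a A s t j \<Longrightarrow> good_shell a A r i \<Longrightarrow> r + 2 * a * 2 ^ i \<le> s \<Longrightarrow>
    shell_chain a A r t (Suc j)"
  by (induction rule: shell_chain.induct) (auto intro: shell_chain.intros)

lemma good_shell_antimono:
  assumes "good_shell a A s i" "A' \<subseteq> A" "finite A"
  shows "good_shell a A' s i"
proof -
  have "card {x\<in>A'. s \<le> sup_norm x \<and> sup_norm x < s + 2 * a * 2 ^ i} \<le> card {x\<in>A. s \<le> sup_norm x \<and> sup_norm x < s + 2 * a * 2 ^ i}"
    using assms by (intro card_mono) auto
  then show ?thesis using assms(1) by (simp add: good_shell_def)
qed

lemma shell_chain_antimono:
  "shell_chain a A s t j \<Longrightarrow> A' \<subseteq> A \<Longrightarrow> finite A \<Longrightarrow> shell_chain a A' s t j"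
  by (induction rule: shell_chain.induct) (auto intro: shell_chain.intros good_shell_antimono)

text \<open>Each shell multiplies the bound valid beyond its inner radius by \<open>1 / 4\<close>,
  starting from the trivial bound 1.\<close>

lemma exit_mean_shell_chain:
  fixes A :: "(int ^ 'd) set"
  assumes A: "finite A" and a: "0 < a" "4 * exit_const (card (unit_steps :: (int ^ 'd) set)) CARD('d) \<le> (real a)\<^sup>2"
    and \<phi>: "\<And>x. s \<le> sup_norm x \<Longrightarrow> \<phi> x = 0" "\<And>x. \<phi> x \<le> 1"
    and chain: "shell_chain a A s t j"
  shows "t \<le> sup_norm x \<Longrightarrow> exit_mean A \<phi> n x \<le> (1 / 4) ^ j"
  using chain
proof (induction arbitrary: x n rule: shell_chain.induct)
  case (no_shell t)
  show ?case using exit_mean_le[of \<phi> 1] \<phi>(2) by simp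
next
  case (add_shell u j i t)
  have "exit_mean A \<phi> n x \<le> (1 / 4) ^ j / 4"
  proof (rule exit_mean_good_shell[OF A a add_shell.hyps(2)])
    show "\<phi> x = 0" if "u \<le> sup_norm x" for x
      using \<phi>(1) shell_chain_le[OF add_shell.hyps(1)] that by simp
  qed (use add_shell in auto)
  then show ?case by simp
qed

text \<open>The alternative \<open>j = 0\<close> keeps the set nonempty for points at level
  \<open>R\<close> or beyond. The strict \<open>sup_norm x < s\<close> puts \<open>x\<close>
  properly inside all counted shells.\<close>

definition shell_depth :: "nat \<Rightarrow> nat \<Rightarrow> (int ^ 'd) set \<Rightarrow> int ^ 'd \<Rightarrow> nat" where
  "shell_depth a R A x = Max {j. j = 0 \<or> (\<exists>s. sup_norm x < s \<and> shell_chain a A s R j)}"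

lemma finite_shell_depths:
  assumes "0 < a"
  shows "finite {j. j = 0 \<or> (\<exists>s. sup_norm x < s \<and> shell_chain a A s R j)}"
proof (rule finite_subset)
  show "{j. j = 0 \<or> (\<exists>s. sup_norm x < s \<and> shell_chain a A s R j)} \<subseteq> {..R}"
    using shell_chain_length[OF assms, of A _ R] by fastforce
qed simp

lemma le_shell_depth_iff:
  assumes "0 < a"
  shows "j \<le> shell_depth a R A x \<longleftrightarrow> j = 0 \<or> (\<exists>s. sup_norm x < s \<and> shell_chain a A s R j)"
proof
  assume j: "j \<le> shell_depth a R A x"
  have "shell_depth a R A x \<in> {j. j = 0 \<or> (\<exists>s. sup_norm x < s \<and> shell_chain a A s R j)}"
    unfolding shell_depth_def by (rule Max_in[OF finite_shell_depths[OF assms]]) auto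
  then show "j = 0 \<or> (\<exists>s. sup_norm x < s \<and> shell_chain a A s R j)"
    using j shell_chain_shorten by fastforce
next
  assume "j = 0 \<or> (\<exists>s. sup_norm x < s \<and> shell_chain a A s R j)"
  then show "j \<le> shell_depth a R A x"
    unfolding shell_depth_def by (intro Max_ge finite_shell_depths[OF assms]) auto
qed

lemma shell_depth_le: "0 < a \<Longrightarrow> shell_depth a R A x \<le> R"
  using le_shell_depth_iff[of a "shell_depth a R A x" R A x] shell_chain_length[of a A _ R] by fastforce

text \<open>Thin shells remain thin in a subset, so points can only lose depth while the cluster
  grows.\<close>

lemma shell_depth_antimono:
  assumes "0 < a" "A' \<subseteq> A" "finite A"
  shows "shell_depth a R A x \<le> shell_depth a R A' x"
  using le_shell_depth_iff[OF assms(1), of "shell_depth a R A x" R A x] shell_chain_antimono[OF _ assms(2,3)]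
  by (subst le_shell_depth_iff[OF assms(1)]) auto

text \<open>Layers: \<open>2 ^ D = 1 + (\<Sum>j<D. 2 ^ j)\<close>, and the exit point has depth
  above \<open>j\<close> with probability at most \<open>(1 / 4) ^ (j + 1)\<close>, so the layers
  add at most 1.\<close>

lemma exit_mean_shell_depth:
  fixes A :: "(int ^ 'd) set"
  assumes A: "finite A" and a: "0 < a" "4 * exit_const (card (unit_steps :: (int ^ 'd) set)) CARD('d) \<le> (real a)\<^sup>2"
    and x: "R \<le> sup_norm x"
  shows "exit_mean A (\<lambda>y. 2 ^ shell_depth a R A y) n x \<le> 2"
proof -
  define \<phi> :: "nat \<Rightarrow> int ^ 'd \<Rightarrow> real" where "\<phi> j y = of_bool (j < shell_depth a R A y)" for j y
  have "exit_mean A (\<phi> j) n x \<le> (1 / 4) ^ Suc j" for j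
  proof (cases "\<exists>y. j < shell_depth a R A y")
    case True
    \<comment> \<open>The largest inner radius of a chain of \<open>j + 1\<close> shells serves all
      points of depth above \<open>j\<close> at once, so a single chain suffices for the crossing
      estimate.\<close>
    define S where "S = {s. shell_chain a A s R (Suc j)}"
    have iff: "j < shell_depth a R A y \<longleftrightarrow> (\<exists>s\<in>S. sup_norm y < s)" for y
      using le_shell_depth_iff[OF a(1), of "Suc j" R A y] by (auto simp: S_def Suc_le_eq)
    have "finite S"
      by (rule finite_subset[of _ "{..R}"]) (auto simp: S_def dest: shell_chain_le)
    moreover have "S \<noteq> {}" using True iff by auto
    ultimately have S: "Max S \<in> S" "\<And>s. s \<in> S \<Longrightarrow> s \<le> Max S" by auto
    show ?thesis
    proof (rule exit_mean_shell_chain[OF A a _ _ _ x])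
      show "\<phi> j y = 0" if "Max S \<le> sup_norm y" for y
        using iff[of y] S(2) that by (force simp: \<phi>_def)
      show "shell_chain a A (Max S) R (Suc j)" using S(1) by (simp add: S_def)
    qed (simp add: \<phi>_def)
  next
    case False
    then have "\<phi> j = (\<lambda>_. 0)" by (auto simp: \<phi>_def)
    then show ?thesis by (simp add: exit_mean_zero)
  qed
  moreover have "(\<lambda>y. 2 ^ shell_depth a R A y) = (\<lambda>y. 1 + (\<Sum>j<R. 2 ^ j * \<phi> j y))"
  proof
    fix y
    have "(\<Sum>j<R'. 2 ^ j * \<phi> j y) = 2 ^ min R' (shell_depth a R A y) - 1" for R'
    proof (induction R')
      case (Suc R')
      then show ?case
        by (cases "R' < shell_depth a R A y") (auto simp: \<phi>_def min_def)
    qed simp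
    from this[of R] show "2 ^ shell_depth a R A y = 1 + (\<Sum>j<R. 2 ^ j * \<phi> j y)"
      using shell_depth_le[OF a(1), of R A y] by (simp add: min_absorb2)
  qed
  then have "exit_mean A (\<lambda>y. 2 ^ shell_depth a R A y) n x
      = exit_mean A (\<lambda>_. 1) n x + (\<Sum>j<R. 2 ^ j * exit_mean A (\<phi> j) n x)"
    by (simp add: exit_mean_add exit_mean_sum exit_mean_cmult)
  ultimately have "exit_mean A (\<lambda>y. 2 ^ shell_depth a R A y) n x \<le> 1 + (\<Sum>j<R. 2 ^ j * (1 / 4) ^ Suc j)"
    using exit_mean_le[of "\<lambda>_. 1" 1 A n x] by (auto intro!: add_mono sum_mono mult_left_mono)
  also have "(\<Sum>j<R. 2 ^ j * (1 / 4) ^ Suc j) = (\<Sum>j<R. (1 / 2) ^ j / (4::real))"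
    by (rule sum.cong) (auto simp: power_divide power_mult_distrib field_simps simp flip: power_mult_distrib)
  also have "\<dots> \<le> 1"
  proof -
    have "2 * (\<Sum>j<R. (1 / 2) ^ j / (4::real)) = 1 - (1 / 2) ^ R"
      by (induction R) (auto simp: algebra_simps)
    moreover have "(0::real) \<le> (1 / 2) ^ R" by simp
    ultimately show ?thesis by linarith
  qed
  finally show ?thesis by simp
qed

section \<open>Exponential moments along the aggregation process\<close>

text \<open>Unlike \<open>settle\<close>, the position at time \<open>t\<close> depends on finitely
  many increments once \<open>A\<close> is fixed, so means can be computed one step at a
  time.\<close>

primrec stopped_walk ::
  "(int ^ 'd) set \<Rightarrow> (nat \<times> nat \<Rightarrow> int ^ 'd) \<Rightarrow> nat \<Rightarrow> int ^ 'd \<Rightarrow> nat \<Rightarrow> int ^ 'd" where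
  "stopped_walk A \<omega> k x 0 = x"
| "stopped_walk A \<omega> k x (Suc t) =
    (if stopped_walk A \<omega> k x t \<in> A then stopped_walk A \<omega> k x t + \<omega> (k, t) else stopped_walk A \<omega> k x t)"

lemma walk_zero [simp]: "walk \<omega> k x 0 = x"
  by (simp add: walk_def)

lemma walk_Suc: "walk \<omega> k x (Suc t) = walk \<omega> k x t + \<omega> (k, t)"
  by (simp add: walk_def add.assoc)

lemma stopped_walk_eq_walk:
  "(\<And>s. s < t \<Longrightarrow> walk \<omega> k x s \<in> A) \<Longrightarrow> stopped_walk A \<omega> k x t = walk \<omega> k x t"
  by (induction t) (simp_all add: walk_Suc)

lemma stopped_walk_after_exit:
  assumes "\<And>s. s < \<tau> \<Longrightarrow> walk \<omega> k x s \<in> A" "walk \<omega> k x \<tau> \<notin> A" "\<tau> \<le> t"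
  shows "stopped_walk A \<omega> k x t = walk \<omega> k x \<tau>"
  using assms(3)
proof (induction rule: dec_induct)
  case base
  show ?case by (rule stopped_walk_eq_walk) (rule assms(1))
qed (use assms(2) in simp)

lemma walk_upd: "fst p \<noteq> k \<Longrightarrow> walk (fun_upd \<omega> p e) k x = walk \<omega> k x"
  by (intro ext) (auto simp: walk_def intro!: sum.cong)

text \<open>The first \<open>k\<close> walks read only increments with first index below
  \<open>k\<close>: the independence of the cluster from the next walk, in the form needed for
  resampling.\<close>

lemma cluster_after_upd: "k \<le> fst p \<Longrightarrow> cluster_after xs k (fun_upd \<omega> p e) = cluster_after xs k \<omega>"
  by (induction k) (simp_all add: walk_upd)

lemma stopped_walk_upd: "t \<le> s \<Longrightarrow> stopped_walk A (fun_upd \<omega> (k, s) e) k x t = stopped_walk A \<omega> k x t"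
  by (induction t) simp_all

lemma finite_cluster_after: "finite (cluster_after xs k \<omega>)"
  by (induction k) (simp_all add: settle_def)

lemma measurable_stopped_walk:
  "(\<lambda>\<omega>. stopped_walk A \<omega> k x t)
    \<in> measurable (walk_space :: (nat \<times> nat \<Rightarrow> int ^ 'd) measure) (count_space UNIV)"
proof (induction t)
  case 0
  show ?case by simp
next
  case (Suc t)
  have "(\<lambda>\<omega>. if stopped_walk A \<omega> k x t \<in> A then stopped_walk A \<omega> k x t + \<omega> (k, t) else stopped_walk A \<omega> k x t)
      \<in> measurable walk_space (count_space (UNIV :: (int ^ 'd) set))"
  proof (rule measurable_compose_countable'[OF _ Suc])
    fix y :: "int ^ 'd"
    show "(\<lambda>\<omega>. if y \<in> A then y + \<omega> (k, t) else y) \<in> measurable walk_space (count_space UNIV)"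
      by (rule measurable_compose[OF measurable_increment, where g = "\<lambda>e. if y \<in> A then y + e else y"]) simp
  qed simp
  then show ?case by simp
qed

lemma measurable_cluster_stopped_walk:
  fixes F :: "(int ^ 'd) set \<Rightarrow> int ^ 'd \<Rightarrow> ennreal"
  shows "(\<lambda>\<omega>. F (cluster_after xs k \<omega>) (stopped_walk (cluster_after xs k \<omega>) \<omega> k' x t))
    \<in> borel_measurable walk_space"
proof (rule measurable_compose_countable'[OF _ measurable_cluster_after])
  fix A :: "(int ^ 'd) set"
  show "(\<lambda>\<omega>. F A (stopped_walk A \<omega> k' x t)) \<in> borel_measurable walk_space"
    by (rule measurable_compose[OF measurable_stopped_walk]) simp
qed (simp add: uncountable_infinite countable_Collect_finite)

lemma measurable_cluster_function:
  fixes F :: "(int ^ 'd) set \<Rightarrow> ennreal"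
  shows "(\<lambda>\<omega>. F (cluster_after xs k \<omega>)) \<in> borel_measurable walk_space"
  using measurable_cluster_stopped_walk[of "\<lambda>A _. F A"] by simp

text \<open>A product measure is unchanged when one coordinate is replaced by an independent copy.
  The inner integral plays the role of the conditional expectation given all other
  increments.\<close>

lemma nn_integral_resample:
  fixes G :: "(nat \<times> nat \<Rightarrow> int ^ 'd) \<Rightarrow> ennreal"
  assumes G: "G \<in> borel_measurable walk_space"
  shows "(\<integral>\<^sup>+\<omega>. G \<omega> \<partial>walk_space)
    = (\<integral>\<^sup>+\<omega>. (\<integral>\<^sup>+e. G (fun_upd \<omega> p e) \<partial>measure_pmf (pmf_of_set unit_steps)) \<partial>walk_space)"
proof -
  let ?P = "measure_pmf (pmf_of_set (unit_steps :: (int ^ 'd) set))"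
  let ?W = "walk_space :: (nat \<times> nat \<Rightarrow> int ^ 'd) measure"
  let ?u = "\<lambda>(e, \<omega>). fun_upd \<omega> p e"
  interpret W: prob_space ?W by (rule prob_space_walk_space)
  interpret PW: pair_sigma_finite ?P ?W ..
  have eq: "distr (?P \<Otimes>\<^sub>M ?W) ?W ?u = ?W"
    using distr_pair_PiM_eq_PiM[of UNIV "\<lambda>_. ?P" p, OF prob_space_measure_pmf prob_space_measure_pmf]
    by (simp add: walk_space_def)
  have u: "?u \<in> measurable (?P \<Otimes>\<^sub>M ?W) ?W"
  proof -
    have "?u \<in> measurable (?P \<Otimes>\<^sub>M ?W) (PiM (insert p UNIV) (\<lambda>_. ?P))"
      unfolding walk_space_def split_beta'
      by (rule measurable_fun_upd[where J = UNIV]) auto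
    then show ?thesis by (simp add: walk_space_def)
  qed
  have "(\<integral>\<^sup>+\<omega>. G \<omega> \<partial>?W) = (\<integral>\<^sup>+z. G (?u z) \<partial>(?P \<Otimes>\<^sub>M ?W))"
    by (subst eq[symmetric]) (rule nn_integral_distr[OF u], simp add: G)
  also have "\<dots> = (\<integral>\<^sup>+\<omega>. (\<integral>\<^sup>+e. G (?u (e, \<omega>)) \<partial>?P) \<partial>?W)"
    by (rule PW.nn_integral_snd[symmetric]) (rule measurable_compose[OF u G])
  finally show ?thesis by simp
qed

section \<open>Expected growth of the cluster weight\<close>

definition cluster_weight :: "nat \<Rightarrow> nat \<Rightarrow> real \<Rightarrow> (int ^ 'd) set \<Rightarrow> real" where
  "cluster_weight a R \<theta> A = (\<Prod>x\<in>A. 1 + \<theta> * 2 ^ shell_depth a R A x)"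

lemma cluster_weight_nonneg: "0 \<le> \<theta> \<Longrightarrow> 0 \<le> cluster_weight a R \<theta> A"
  unfolding cluster_weight_def by (intro prod_nonneg) simp

text \<open>Depths only decrease, so old factors shrink and the new factor is bounded by the depth
  of \<open>x\<close> before its insertion, which the exit estimates control.\<close>

lemma cluster_weight_insert_le:
  assumes "finite A" "x \<notin> A" "0 \<le> \<theta>" "0 < a"
  shows "cluster_weight a R \<theta> (insert x A) \<le> cluster_weight a R \<theta> A * (1 + \<theta> * 2 ^ shell_depth a R A x)"
proof -
  have le: "1 + \<theta> * 2 ^ shell_depth a R (insert x A) y \<le> 1 + \<theta> * 2 ^ shell_depth a R A y" for y
    using assms shell_depth_antimono[of a A "insert x A" R y]
    by (intro add_left_mono mult_left_mono power_increasing) auto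
  have "cluster_weight a R \<theta> (insert x A) =
      (1 + \<theta> * 2 ^ shell_depth a R (insert x A) x) * (\<Prod>y\<in>A. 1 + \<theta> * 2 ^ shell_depth a R (insert x A) y)"
    using assms by (simp add: cluster_weight_def)
  also have "\<dots> \<le> (1 + \<theta> * 2 ^ shell_depth a R A x) * cluster_weight a R \<theta> A"
    unfolding cluster_weight_def using assms
    by (intro mult_mono le prod_mono prod_nonneg conjI) auto
  finally show ?thesis by (simp add: mult.commute)
qed

text \<open>The mean bound for the weight after a walk that stands at \<open>x\<close> and has
  \<open>n\<close> steps left; a path that does not leave \<open>A\<close> in time contributes the
  factor 1.\<close>

definition exit_weight :: "nat \<Rightarrow> nat \<Rightarrow> real \<Rightarrow> nat \<Rightarrow> (int ^ 'd) set \<Rightarrow> int ^ 'd \<Rightarrow> real" where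
  "exit_weight a R \<theta> n A x =
    cluster_weight a R \<theta> A * (1 + \<theta> * exit_mean A (\<lambda>y. 2 ^ shell_depth a R A y) n x)"

lemma exit_weight_nonneg: "0 \<le> \<theta> \<Longrightarrow> 0 \<le> exit_weight a R \<theta> n A x"
  unfolding exit_weight_def
  by (intro mult_nonneg_nonneg add_nonneg_nonneg cluster_weight_nonneg exit_mean_nonneg) auto

lemma avg_exit_weight:
  "x \<in> A \<Longrightarrow> avg (exit_weight a R \<theta> n A) x = exit_weight a R \<theta> (Suc n) A x"
  unfolding exit_weight_def by (simp add: avg_cmult avg_add)

lemma nn_integral_unit_step:
  fixes h :: "int ^ 'd \<Rightarrow> real"
  assumes "\<And>x. 0 \<le> h x"
  shows "(\<integral>\<^sup>+e. ennreal (h (x + e)) \<partial>measure_pmf (pmf_of_set unit_steps)) = ennreal (avg h x)"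
proof -
  have "(\<integral>\<^sup>+e. ennreal (h (x + e)) \<partial>measure_pmf (pmf_of_set (unit_steps :: (int ^ 'd) set)))
      = (\<Sum>e\<in>unit_steps. ennreal (h (x + e))) / real (card (unit_steps :: (int ^ 'd) set))"
    by (simp add: nn_integral_pmf_of_set finite_unit_steps unit_steps_nonempty
        flip: ennreal_of_nat_eq_real_of_nat)
  also have "\<dots> = ennreal (avg h x)"
    using assms card_unit_steps_pos[where 'd='d] by (simp add: avg_def sum_ennreal divide_ennreal sum_nonneg)
  finally show ?thesis .
qed

text \<open>Resampling increment \<open>(k, t)\<close> changes neither the earlier cluster nor the
  position at time \<open>t\<close>. A walk still inside is averaged over one step, which trades a
  unit of \<open>t\<close> for one of \<open>n\<close>; outside, both sides agree.\<close>

lemma nn_integral_exit_weight_step: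
  fixes xs :: "(int ^ 'd) list" and k :: nat
  assumes "0 \<le> \<theta>"
  defines "A \<equiv> cluster_after xs k"
  shows "(\<integral>\<^sup>+\<omega>. ennreal (exit_weight a R \<theta> n (A \<omega>) (stopped_walk (A \<omega>) \<omega> k x (Suc t))) \<partial>walk_space)
    = (\<integral>\<^sup>+\<omega>. ennreal (exit_weight a R \<theta> (Suc n) (A \<omega>) (stopped_walk (A \<omega>) \<omega> k x t)) \<partial>walk_space)"
proof -
  let ?v = "exit_weight a R \<theta>"
  have "(\<integral>\<^sup>+\<omega>. ennreal (?v n (A \<omega>) (stopped_walk (A \<omega>) \<omega> k x (Suc t))) \<partial>walk_space)
    = (\<integral>\<^sup>+\<omega>. (\<integral>\<^sup>+e. ennreal (?v n (A (fun_upd \<omega> (k, t) e))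
        (stopped_walk (A (fun_upd \<omega> (k, t) e)) (fun_upd \<omega> (k, t) e) k x (Suc t)))
        \<partial>measure_pmf (pmf_of_set unit_steps)) \<partial>walk_space)"
    unfolding A_def
    by (rule nn_integral_resample[where p = "(k, t)"]) (rule measurable_cluster_stopped_walk)
  also have "\<dots> = (\<integral>\<^sup>+\<omega>. ennreal (?v (Suc n) (A \<omega>) (stopped_walk (A \<omega>) \<omega> k x t)) \<partial>walk_space)"
  proof (rule nn_integral_cong)
    fix \<omega> :: "nat \<times> nat \<Rightarrow> int ^ 'd"
    let ?y = "stopped_walk (A \<omega>) \<omega> k x t"
    have A: "A (fun_upd \<omega> (k, t) e) = A \<omega>" for e
      by (simp add: A_def cluster_after_upd)
    show "(\<integral>\<^sup>+e. ennreal (?v n (A (fun_upd \<omega> (k, t) e))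
        (stopped_walk (A (fun_upd \<omega> (k, t) e)) (fun_upd \<omega> (k, t) e) k x (Suc t)))
        \<partial>measure_pmf (pmf_of_set unit_steps)) = ennreal (?v (Suc n) (A \<omega>) ?y)"
    proof (cases "?y \<in> A \<omega>")
      case True
      then show ?thesis
        using nn_integral_unit_step[of "?v n (A \<omega>)" ?y, OF exit_weight_nonneg[OF assms(1)]]
        by (simp add: A stopped_walk_upd avg_exit_weight)
    next
      case False
      then show ?thesis
        by (simp add: A stopped_walk_upd exit_weight_def exit_mean_outside measure_pmf.emeasure_space_1[simplified])
    qed
  qed
  finally show ?thesis .
qed

lemma nn_integral_exit_weight:
  fixes xs :: "(int ^ 'd) list" and k :: nat
  assumes "0 \<le> \<theta>"
  defines "A \<equiv> cluster_after xs k"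
  shows "(\<integral>\<^sup>+\<omega>. ennreal (exit_weight a R \<theta> n (A \<omega>) (stopped_walk (A \<omega>) \<omega> k x t)) \<partial>walk_space)
    = (\<integral>\<^sup>+\<omega>. ennreal (exit_weight a R \<theta> (n + t) (A \<omega>) x) \<partial>walk_space)"
proof (induction t arbitrary: n)
  case (Suc t)
  then show ?case
    using nn_integral_exit_weight_step[OF assms(1), of a R n xs k x t] by (simp add: A_def)
qed simp

text \<open>From the settling time on, the stopped walk rests at the settling site and the insertion
  bound applies; a walk that never exits leaves the cluster as it is. The limit inferior prepares
  Fatou's lemma.\<close>

lemma cluster_weight_settle_le_liminf:
  assumes "finite A" "0 \<le> \<theta>" "0 < a"
  shows "ennreal (cluster_weight a R \<theta> (settle A (walk \<omega> k x)))
    \<le> liminf (\<lambda>t. ennreal (exit_weight a R \<theta> 0 A (stopped_walk A \<omega> k x t)))"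
proof (rule Liminf_bounded)
  show "\<forall>\<^sub>F t in sequentially. ennreal (cluster_weight a R \<theta> (settle A (walk \<omega> k x)))
      \<le> ennreal (exit_weight a R \<theta> 0 A (stopped_walk A \<omega> k x t))"
  proof (cases "\<exists>t. walk \<omega> k x t \<notin> A")
    case True
    define \<tau> where "\<tau> = (LEAST t. walk \<omega> k x t \<notin> A)"
    have \<tau>: "walk \<omega> k x \<tau> \<notin> A" "\<And>s. s < \<tau> \<Longrightarrow> walk \<omega> k x s \<in> A"
      using LeastI_ex[OF True] not_less_Least[of _ "\<lambda>t. walk \<omega> k x t \<notin> A"] by (auto simp: \<tau>_def)
    have "settle A (walk \<omega> k x) = insert (walk \<omega> k x \<tau>) A"
      using True by (simp add: settle_def \<tau>_def)
    then have "cluster_weight a R \<theta> (settle A (walk \<omega> k x)) \<le> exit_weight a R \<theta> 0 A (stopped_walk A \<omega> k x t)"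
      if "\<tau> \<le> t" for t
      using cluster_weight_insert_le[OF assms(1) \<tau>(1) assms(2,3), of R] stopped_walk_after_exit[OF \<tau>(2) \<tau>(1) that] \<tau>(1)
      by (simp add: exit_weight_def)
    then show ?thesis
      unfolding eventually_sequentially by (blast intro: ennreal_leI)
  next
    case False
    have "cluster_weight a R \<theta> A \<le> exit_weight a R \<theta> 0 A y" for y
    proof -
      have "0 \<le> \<theta> * exit_mean A (\<lambda>y. 2 ^ shell_depth a R A y) 0 y"
        by (intro mult_nonneg_nonneg assms(2) exit_mean_nonneg) simp
      then have "cluster_weight a R \<theta> A * 1 \<le> exit_weight a R \<theta> 0 A y"
        unfolding exit_weight_def by (intro mult_left_mono cluster_weight_nonneg assms(2)) simp
      then show ?thesis by simp
    qed
    then show ?thesis using False by (intro always_eventually allI ennreal_leI) (simp add: settle_def)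
  qed
qed

text \<open>Fatou's lemma passes from stopped walks to the settled one, and at every horizon a start
  at level \<open>R\<close> or beyond gives the factor \<open>1 + 2 * \<theta>\<close>.\<close>

lemma nn_integral_cluster_weight_Suc:
  fixes xs :: "(int ^ 'd) list"
  assumes \<theta>: "0 \<le> \<theta>"
    and a: "0 < a" "4 * exit_const (card (unit_steps :: (int ^ 'd) set)) CARD('d) \<le> (real a)\<^sup>2"
    and R: "R \<le> sup_norm (xs ! k)"
  shows "(\<integral>\<^sup>+\<omega>. ennreal (cluster_weight a R \<theta> (cluster_after xs (Suc k) \<omega>)) \<partial>walk_space)
    \<le> ennreal (1 + 2 * \<theta>) * (\<integral>\<^sup>+\<omega>. ennreal (cluster_weight a R \<theta> (cluster_after xs k \<omega>)) \<partial>walk_space)"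
proof -
  let ?A = "cluster_after xs k" and ?x = "xs ! k"
  let ?u = "\<lambda>t \<omega>. ennreal (exit_weight a R \<theta> 0 (?A \<omega>) (stopped_walk (?A \<omega>) \<omega> k ?x t))"
  have "(\<integral>\<^sup>+\<omega>. ennreal (cluster_weight a R \<theta> (cluster_after xs (Suc k) \<omega>)) \<partial>walk_space)
      \<le> (\<integral>\<^sup>+\<omega>. liminf (\<lambda>t. ?u t \<omega>) \<partial>walk_space)"
    by (rule nn_integral_mono) (simp add: cluster_weight_settle_le_liminf finite_cluster_after \<theta> a)
  also have "\<dots> \<le> liminf (\<lambda>t. \<integral>\<^sup>+\<omega>. ?u t \<omega> \<partial>walk_space)"
    by (rule nn_integral_liminf) (rule measurable_cluster_stopped_walk)
  also have "\<dots> \<le> (\<integral>\<^sup>+\<omega>. ennreal (1 + 2 * \<theta>) * ennreal (cluster_weight a R \<theta> (?A \<omega>)) \<partial>walk_space)"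
  proof (rule Liminf_le[OF sequentially_bot always_eventually], rule allI)
    fix t
    have "(\<integral>\<^sup>+\<omega>. ?u t \<omega> \<partial>walk_space) = (\<integral>\<^sup>+\<omega>. ennreal (exit_weight a R \<theta> t (?A \<omega>) ?x) \<partial>walk_space)"
      using nn_integral_exit_weight[OF \<theta>, of a R 0 xs k ?x t] by simp
    also have "\<dots> \<le> (\<integral>\<^sup>+\<omega>. ennreal (1 + 2 * \<theta>) * ennreal (cluster_weight a R \<theta> (?A \<omega>)) \<partial>walk_space)"
    proof (rule nn_integral_mono)
      fix \<omega>
      have "exit_weight a R \<theta> t (?A \<omega>) ?x \<le> cluster_weight a R \<theta> (?A \<omega>) * (1 + \<theta> * 2)"
        unfolding exit_weight_def using \<theta> exit_mean_shell_depth[OF finite_cluster_after a R]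
        by (intro mult_left_mono add_left_mono cluster_weight_nonneg) auto
      then show "ennreal (exit_weight a R \<theta> t (?A \<omega>) ?x) \<le> ennreal (1 + 2 * \<theta>) * ennreal (cluster_weight a R \<theta> (?A \<omega>))"
        using \<theta> cluster_weight_nonneg[OF \<theta>, of a R "?A \<omega>"]
        by (subst ennreal_mult[symmetric]) (auto simp: mult.commute intro!: ennreal_leI)
    qed
    finally show "(\<integral>\<^sup>+\<omega>. ?u t \<omega> \<partial>walk_space)
      \<le> (\<integral>\<^sup>+\<omega>. ennreal (1 + 2 * \<theta>) * ennreal (cluster_weight a R \<theta> (?A \<omega>)) \<partial>walk_space)" .
  qed
  also have "\<dots> = ennreal (1 + 2 * \<theta>) * (\<integral>\<^sup>+\<omega>. ennreal (cluster_weight a R \<theta> (?A \<omega>)) \<partial>walk_space)"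
    by (rule nn_integral_cmult) (rule measurable_cluster_function)
  finally show ?thesis .
qed

lemma nn_integral_cluster_weight:
  fixes xs :: "(int ^ 'd) list"
  assumes \<theta>: "0 \<le> \<theta>"
    and a: "0 < a" "4 * exit_const (card (unit_steps :: (int ^ 'd) set)) CARD('d) \<le> (real a)\<^sup>2"
    and R: "\<And>x. x \<in> set xs \<Longrightarrow> R \<le> sup_norm x"
  shows "k \<le> length xs \<Longrightarrow>
    (\<integral>\<^sup>+\<omega>. ennreal (cluster_weight a R \<theta> (cluster_after xs k \<omega>)) \<partial>walk_space) \<le> ennreal ((1 + 2 * \<theta>) ^ k)"
proof (induction k)
  case 0
  interpret prob_space "walk_space :: (nat \<times> nat \<Rightarrow> int ^ 'd) measure" by (rule prob_space_walk_space)
  show ?case by (simp add: cluster_weight_def emeasure_space_1)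
next
  case (Suc k)
  then have "R \<le> sup_norm (xs ! k)" by (intro R) simp
  from nn_integral_cluster_weight_Suc[OF \<theta> a this]
  have "(\<integral>\<^sup>+\<omega>. ennreal (cluster_weight a R \<theta> (cluster_after xs (Suc k) \<omega>)) \<partial>walk_space)
    \<le> ennreal (1 + 2 * \<theta>) * (\<integral>\<^sup>+\<omega>. ennreal (cluster_weight a R \<theta> (cluster_after xs k \<omega>)) \<partial>walk_space)" .
  also have "\<dots> \<le> ennreal (1 + 2 * \<theta>) * ennreal ((1 + 2 * \<theta>) ^ k)"
    using Suc by (intro mult_left_mono) auto
  also have "\<dots> = ennreal ((1 + 2 * \<theta>) ^ Suc k)"
    using \<theta> by (subst ennreal_mult[symmetric]) auto
  finally show ?case .
qed

section \<open>Levels met by the cluster\<close>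

definition levels_filled :: "nat \<Rightarrow> (int ^ 'd) set \<Rightarrow> bool" where
  "levels_filled R A \<longleftrightarrow> (\<forall>x\<in>A. \<forall>s. sup_norm x \<le> s \<and> s < R \<longrightarrow> (\<exists>y\<in>A. sup_norm y = s))"

text \<open>A nearest-neighbour path from level \<open>R\<close> or beyond visits every level below
  \<open>R\<close> down to that of its settling site, and all sites before the settling time lie in
  \<open>A\<close>.\<close>

lemma levels_filled_settle:
  assumes A: "levels_filled R A" and x: "R \<le> sup_norm x" and \<omega>: "\<And>p. \<omega> p \<in> unit_steps"
  shows "levels_filled R (settle A (walk \<omega> k x))"
proof (cases "\<exists>t. walk \<omega> k x t \<notin> A")
  case True
  let ?S = "walk \<omega> k x"
  define \<tau> where "\<tau> = (LEAST t. ?S t \<notin> A)"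
  have \<tau>: "\<And>s. s < \<tau> \<Longrightarrow> ?S s \<in> A"
    using not_less_Least[of _ "\<lambda>t. ?S t \<notin> A"] by (auto simp: \<tau>_def)
  have settle: "settle A ?S = insert (?S \<tau>) A"
    using True by (simp add: settle_def \<tau>_def)
  have "\<exists>y\<in>insert (?S \<tau>) A. sup_norm y = s" if s: "sup_norm (?S \<tau>) \<le> s" "s < R" for s
  proof -
    define t where "t = (LEAST t. sup_norm (?S t) \<le> s)"
    have t: "sup_norm (?S t) \<le> s" unfolding t_def by (rule LeastI) (rule s(1))
    have "t \<le> \<tau>" unfolding t_def by (rule Least_le) (rule s(1))
    have "t \<noteq> 0" using t x s(2) by (intro notI) simp
    then obtain t' where t': "t = Suc t'" by (cases t) auto
    have "\<not> sup_norm (?S t') \<le> s" by (rule not_less_Least) (simp add: t' flip: t_def)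
    moreover have "sup_norm (?S t') \<le> Suc (sup_norm (?S t))"
      unfolding t' walk_Suc by (rule sup_norm_step(2)[OF \<omega>])
    ultimately have "sup_norm (?S t) = s" using t by linarith
    moreover have "?S t \<in> insert (?S \<tau>) A" using \<open>t \<le> \<tau>\<close> \<tau>[of t] by (cases "t = \<tau>") auto
    ultimately show ?thesis by blast
  qed
  then show ?thesis using A unfolding settle levels_filled_def by blast
qed (use A in \<open>simp add: settle_def\<close>)

lemma levels_filled_cluster_after:
  assumes "\<And>x. x \<in> set xs \<Longrightarrow> R \<le> sup_norm x" "\<And>p. \<omega> p \<in> unit_steps"
  shows "k \<le> length xs \<Longrightarrow> levels_filled R (cluster_after xs k \<omega>)"
proof (induction k)
  case (Suc k)
  then show ?case using assms by (auto intro!: levels_filled_settle)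
qed (simp add: levels_filled_def)

text \<open>The sample space contains all functions, whereas the path argument for filled levels
  needs genuine unit steps.\<close>

lemma AE_unit_steps:
  "AE \<omega> in (walk_space :: (nat \<times> nat \<Rightarrow> int ^ 'd) measure). \<forall>p. \<omega> p \<in> unit_steps"
proof (subst AE_all_countable, rule allI)
  fix p :: "nat \<times> nat"
  have "AE e in measure_pmf (pmf_of_set unit_steps). e \<in> (unit_steps :: (int ^ 'd) set)"
    by (simp add: AE_measure_pmf_iff set_pmf_of_set[OF unit_steps_nonempty finite_unit_steps])
  then show "AE \<omega> in (walk_space :: (nat \<times> nat \<Rightarrow> int ^ 'd) measure). \<omega> p \<in> unit_steps"
    unfolding walk_space_def by (intro AE_PiM_component prob_space_measure_pmf) auto
qed

lemma card_cluster_after_le: "card (cluster_after xs k \<omega>) \<le> k"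
proof (induction k)
  case (Suc k)
  have "card (cluster_after xs (Suc k) \<omega>) \<le> Suc (card (cluster_after xs k \<omega>))"
    by (simp add: settle_def card_insert_le_m1 card_insert_if finite_cluster_after)
  then show ?case using Suc by simp
qed simp

section \<open>Cost of a cluster that reaches the origin\<close>

text \<open>The least \<open>i\<close> whose shell just below \<open>t\<close> is good works. Scale
  \<open>k\<close> is a candidate because all of \<open>A\<close> is small enough, and by minimality
  the shell of half the width contains at least \<open>2 ^ (d * (i - 1))\<close> points.\<close>

lemma outermost_good_shell:
  fixes A :: "(int ^ 'd) set"
  assumes A: "finite A" and filled: "\<And>s. s < R \<Longrightarrow> \<exists>y\<in>A. sup_norm y = s"
    and a: "0 < a" and t: "t \<le> R" "2 * a * 2 ^ k \<le> t" "card A < 2 ^ (CARD('d) * k)"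
  obtains i where "2 * a * 2 ^ i \<le> t" "good_shell a A (t - 2 * a * 2 ^ i) i"
    "(2 ^ i / 2) ^ CARD('d) \<le> real (card {x\<in>A. t - 2 * a * 2 ^ i \<le> sup_norm x \<and> sup_norm x < t})"
proof -
  define P where "P i \<longleftrightarrow> 2 * a * 2 ^ i \<le> t \<and> good_shell a A (t - 2 * a * 2 ^ i) i" for i
  have "card {x\<in>A. t - 2 * a * 2 ^ k \<le> sup_norm x \<and> sup_norm x < t - 2 * a * 2 ^ k + 2 * a * 2 ^ k} \<le> card A"
    using A by (intro card_mono) auto
  then have "P k" using t by (simp add: P_def good_shell_def)
  define i where "i = (LEAST i. P i)"
  have Pi: "P i" and min: "\<And>j. j < i \<Longrightarrow> \<not> P j"
    using \<open>P k\<close> by (auto simp: i_def intro: LeastI dest: not_less_Least)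
  let ?S = "\<lambda>j. {x\<in>A. t - 2 * a * 2 ^ j \<le> sup_norm x \<and> sup_norm x < t}"
  have S_eq: "{x\<in>A. t - 2 * a * 2 ^ j \<le> sup_norm x \<and> sup_norm x < t - 2 * a * 2 ^ j + 2 * a * 2 ^ j} = ?S j"
    if "2 * a * 2 ^ j \<le> t" for j using that by simp
  \<comment> \<open>At scale 0 a good shell contains no point of \<open>A\<close>, but the level
    \<open>t - 1\<close> is occupied.\<close>
  have "i \<noteq> 0"
  proof
    assume "i = 0"
    have t0: "2 * a \<le> t" using Pi \<open>i = 0\<close> by (simp add: P_def)
    then have "t - 1 < R" using t(1) a by linarith
    then obtain y where "y \<in> A" "sup_norm y = t - 1" using filled by blast
    then have "y \<in> ?S 0" using t0 a by auto
    then have "card (?S 0) \<noteq> 0" using A by auto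
    then show False using Pi S_eq[of 0] \<open>i = 0\<close> t0 by (simp add: P_def good_shell_def)
  qed
  then obtain j where j: "i = Suc j" by (cases i) auto
  have le: "2 * a * 2 ^ j \<le> 2 * a * 2 ^ i" by (simp add: j)
  then have jt: "2 * a * 2 ^ j \<le> t" using Pi unfolding P_def by linarith
  then have "\<not> good_shell a A (t - 2 * a * 2 ^ j) j" using min[of j] by (simp add: P_def j)
  then have "2 ^ (CARD('d) * j) \<le> card (?S j)"
    unfolding good_shell_def S_eq[OF jt] by simp
  also have "\<dots> \<le> card (?S i)"
    using A diff_le_mono2[OF le, of t] by (intro card_mono) (auto simp del: power_Suc mult_le_mono)
  finally have "real (2 ^ (CARD('d) * j)) \<le> real (card (?S i))" by (rule of_nat_mono)
  moreover have "real (2 ^ (CARD('d) * j)) = (2 ^ i / 2) ^ CARD('d)"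
    by (simp add: j mult.commute[of "CARD('d)"] power_mult)
  ultimately have "(2 ^ i / 2) ^ CARD('d) \<le> real (card (?S i))" by linarith
  then show thesis using that[of i] Pi unfolding P_def by blast
qed

text \<open>Good shells are cut off inward from \<open>R\<close> until the remaining radius is below
  \<open>R / 2\<close>. The \<open>l\<close>-th one has width \<open>2 * a * w l\<close> and at
  least \<open>(w l / 2) ^ d\<close> points, which lie inside the \<open>l\<close> earlier shells
  and so have depth at least \<open>l\<close>.\<close>

lemma shell_decomposition:
  fixes A :: "(int ^ 'd) set" and \<Gamma> :: "nat \<Rightarrow> real"
  assumes A: "finite A" and filled: "\<And>s. s < R \<Longrightarrow> \<exists>y\<in>A. sup_norm y = s"
    and a: "0 < a" and k: "4 * a * 2 ^ k \<le> R" "card A < 2 ^ (CARD('d) * k)"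
    and \<Gamma>: "mono \<Gamma>" "\<And>l. 0 \<le> \<Gamma> l"
  obtains n w where "n \<le> R" "\<And>l. l < n \<Longrightarrow> 1 \<le> w l" "real R \<le> 4 * real a * (\<Sum>l<n. w l)"
    "(\<Sum>l<n. \<Gamma> l * (w l / 2) ^ CARD('d)) \<le> (\<Sum>x\<in>A. \<Gamma> (shell_depth a R A x))"
proof -
  define state where "state n w t \<longleftrightarrow> real t + 2 * real a * (\<Sum>l<n. w l) = real R \<and>
      shell_chain a A t R n \<and> (\<forall>l<n. 1 \<le> w l) \<and>
      (\<Sum>l<n. \<Gamma> l * (w l / 2) ^ CARD('d)) \<le> (\<Sum>x\<in>{x\<in>A. t \<le> sup_norm x}. \<Gamma> (shell_depth a R A x))"
    for n :: nat and w :: "nat \<Rightarrow> real" and t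
  have step: "\<exists>w' t'. state (Suc n) w' t'" if st: "state n w t" and t: "R \<le> 2 * t" for n w t
  proof -
    have chain: "shell_chain a A t R n" using st by (simp add: state_def)
    have "t \<le> R" using shell_chain_le[OF chain] .
    moreover have "2 * a * 2 ^ k \<le> t" using k(1) t by linarith
    ultimately obtain i where i: "2 * a * 2 ^ i \<le> t" "good_shell a A (t - 2 * a * 2 ^ i) i"
      "(2 ^ i / 2) ^ CARD('d) \<le> real (card {x\<in>A. t - 2 * a * 2 ^ i \<le> sup_norm x \<and> sup_norm x < t})"
      using outermost_good_shell[OF A filled a _ _ k(2), of R t] by blast
    define t' where "t' = t - 2 * a * 2 ^ i"
    define w' where "w' = w(n := 2 ^ i)"
    have t': "t' + 2 * a * 2 ^ i = t" using i(1) by (simp add: t'_def)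
    have w': "(\<Sum>l<n. f l (w' l)) = (\<Sum>l<n. f l (w l))" for f :: "nat \<Rightarrow> real \<Rightarrow> real"
      by (intro sum.cong) (auto simp: w'_def)
    have "shell_chain a A t' R (Suc n)"
      using shell_chain_add_inner[OF chain i(2)] i(1) by (simp add: t'_def)
    moreover have "real t' + 2 * real a * (\<Sum>l<Suc n. w' l) = real R"
    proof -
      have "real t = real t' + 2 * real a * 2 ^ i" by (simp flip: t')
      then show ?thesis using st w'[of "\<lambda>_ x. x"] by (simp add: state_def w'_def algebra_simps)
    qed
    moreover have "\<forall>l<Suc n. 1 \<le> w' l" using st by (auto simp: state_def w'_def)
    moreover have "(\<Sum>l<Suc n. \<Gamma> l * (w' l / 2) ^ CARD('d)) \<le> (\<Sum>x\<in>{x\<in>A. t' \<le> sup_norm x}. \<Gamma> (shell_depth a R A x))"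
    proof -
      have "\<Gamma> n * (w' n / 2) ^ CARD('d) \<le> \<Gamma> n * real (card {x\<in>A. t' \<le> sup_norm x \<and> sup_norm x < t})"
        using i(3) \<Gamma>(2) by (intro mult_left_mono) (auto simp: w'_def t'_def)
      also have "\<dots> = (\<Sum>x\<in>{x\<in>A. t' \<le> sup_norm x \<and> sup_norm x < t}. \<Gamma> n)" by simp
      also have "\<dots> \<le> (\<Sum>x\<in>{x\<in>A. t' \<le> sup_norm x \<and> sup_norm x < t}. \<Gamma> (shell_depth a R A x))"
        using chain by (intro sum_mono monoD[OF \<Gamma>(1)]) (auto simp: le_shell_depth_iff[OF a])
      finally have "(\<Sum>l<Suc n. \<Gamma> l * (w' l / 2) ^ CARD('d))
          \<le> (\<Sum>x\<in>{x\<in>A. t \<le> sup_norm x}. \<Gamma> (shell_depth a R A x))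
            + (\<Sum>x\<in>{x\<in>A. t' \<le> sup_norm x \<and> sup_norm x < t}. \<Gamma> (shell_depth a R A x))"
        using st w'[of "\<lambda>l x. \<Gamma> l * (x / 2) ^ CARD('d)"] by (simp add: state_def)
      also have "\<dots> = (\<Sum>x\<in>{x\<in>A. t \<le> sup_norm x} \<union> {x\<in>A. t' \<le> sup_norm x \<and> sup_norm x < t}. \<Gamma> (shell_depth a R A x))"
        using A by (intro sum.union_disjoint[symmetric]) auto
      also have "{x\<in>A. t \<le> sup_norm x} \<union> {x\<in>A. t' \<le> sup_norm x \<and> sup_norm x < t} = {x\<in>A. t' \<le> sup_norm x}"
        using t' by auto
      finally show ?thesis .
    qed
    ultimately show ?thesis unfolding state_def by blast
  qed
  \<comment> \<open>The process stops, since a chain within radius \<open>R\<close> has at most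
    \<open>R\<close> shells.\<close>
  have "\<exists>n w t. state n w t \<and> 2 * t < R"
  proof (rule ccontr)
    assume "\<not> ?thesis"
    then have no_stop: "R \<le> 2 * t" if "state n w t" for n w t using that by force
    have "\<exists>w t. state n w t" for n
    proof (induction n)
      case 0
      have "state 0 (\<lambda>_. 0) R" using \<Gamma>(2) by (auto simp: state_def intro: shell_chain.intros sum_nonneg)
      then show ?case by blast
    qed (use step no_stop in blast)
    from this[of "Suc R"] obtain t where "shell_chain a A t R (Suc R)" by (auto simp: state_def)
    from shell_chain_length[OF a this] show False by simp
  qed
  then obtain n w t where st: "state n w t" and t: "2 * t < R" by blast
  show thesis
  proof (rule that[of n w])
    show "n \<le> R" using st shell_chain_length[OF a, of A t R n] by (simp add: state_def)
    show "1 \<le> w l" if "l < n" for l using st that by (simp add: state_def)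
    have "2 * real t \<le> real R" using t by linarith
    then show "real R \<le> 4 * real a * (\<Sum>l<n. w l)" using st unfolding state_def by linarith
    have "(\<Sum>x\<in>{x\<in>A. t \<le> sup_norm x}. \<Gamma> (shell_depth a R A x)) \<le> (\<Sum>x\<in>A. \<Gamma> (shell_depth a R A x))"
      using A \<Gamma>(2) by (intro sum_mono2) auto
    then show "(\<Sum>l<n. \<Gamma> l * (w l / 2) ^ CARD('d)) \<le> (\<Sum>x\<in>A. \<Gamma> (shell_depth a R A x))"
      using st by (simp add: state_def)
  qed
qed

section \<open>Inequalities for sums of shell widths\<close>

lemma ln_one_plus_ge_half:
  fixes y :: real
  assumes "0 \<le> y" "y \<le> 1"
  shows "y / 2 \<le> ln (1 + y)"
proof -
  have "ln (1 / (1 + y)) \<le> 1 / (1 + y) - 1" using assms by (intro ln_le_minus_one) auto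
  then have "y / (1 + y) \<le> ln (1 + y)" using assms by (simp add: ln_div field_simps)
  moreover have "y / 2 \<le> y / (1 + y)" using assms by (intro divide_left_mono) auto
  ultimately show ?thesis by linarith
qed

lemma ln_one_plus_power2_ge: "(real j + 1) / 4 \<le> ln (1 + 2 ^ j)"
proof (cases "j = 0")
  case True
  then show ?thesis using ln_one_plus_ge_half[of 1] by simp
next
  case False
  have "real j / 2 \<le> real j * ln 2"
    using ln_one_plus_ge_half[of 1] mult_left_mono[of "1/2" "ln 2" "real j"] by simp
  also have "\<dots> = ln (2 ^ j)" by (simp add: ln_realpow)
  also have "\<dots> \<le> ln (1 + 2 ^ j)" by (subst ln_le_cancel_iff) (auto simp: add_pos_pos)
  finally show ?thesis using False by (simp add: field_simps)
qed

lemma sum_inverse_Suc_le: "0 < n \<Longrightarrow> (\<Sum>j<n. 1 / (real j + 1)) \<le> 1 + ln (real n)"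
proof (induction n rule: nat_induct_non_zero)
  case (Suc n)
  have "ln (real n / (real n + 1)) \<le> real n / (real n + 1) - 1"
    using Suc.hyps by (intro ln_le_minus_one) auto
  then have "1 / (real n + 1) \<le> ln (real n + 1) - ln (real n)"
    using Suc.hyps by (simp add: ln_div field_simps)
  then show ?case using Suc.IH by (simp add: add.commute)
qed simp

lemma sum_inverse_sqrt_Suc_le: "(\<Sum>j<n. 1 / sqrt (real j + 1)) \<le> 2 * sqrt (real n)"
proof (induction n)
  case (Suc n)
  let ?p = "sqrt (real n)" and ?q = "sqrt (real n + 1)"
  have q: "?q > 0" by simp
  have "2 * ?p * ?q \<le> ?p\<^sup>2 + ?q\<^sup>2" using sum_squares_bound[of ?p ?q] by simp
  moreover have "?q * ?q = real n + 1" "?p\<^sup>2 = real n" "?q\<^sup>2 = real n + 1" by auto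
  ultimately have "2 * ?p * ?q + 1 \<le> 2 * (?q * ?q)" by linarith
  then have "2 * ?p + 1 / ?q \<le> 2 * ?q" using q by (simp add: field_simps)
  then show ?case using Suc by (simp add: add.commute)
qed simp

text \<open>Cauchy--Schwarz against \<open>1 / sqrt (j + 1)\<close>; the harmonic sum is the source
  of the logarithm in dimension 2.\<close>

lemma sum_linear_weight_square:
  fixes u :: "nat \<Rightarrow> real"
  assumes "0 < n"
  shows "(\<Sum>j<n. u j)\<^sup>2 \<le> (\<Sum>j<n. (real j + 1) * (u j)\<^sup>2) * (1 + ln (real n))"
proof -
  have "(\<Sum>j<n. u j)\<^sup>2 = (\<Sum>j<n. (sqrt (real j + 1) * u j) * (1 / sqrt (real j + 1)))\<^sup>2"
    by (intro arg_cong[where f = "\<lambda>x. x\<^sup>2"] sum.cong) auto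
  also have "\<dots> \<le> (\<Sum>j<n. (sqrt (real j + 1) * u j)\<^sup>2) * (\<Sum>j<n. (1 / sqrt (real j + 1))\<^sup>2)"
    by (rule Cauchy_Schwarz_ineq_sum)
  also have "\<dots> = (\<Sum>j<n. (real j + 1) * (u j)\<^sup>2) * (\<Sum>j<n. 1 / (real j + 1))"
    by (simp add: power_mult_distrib power_divide)
  also have "\<dots> \<le> (\<Sum>j<n. (real j + 1) * (u j)\<^sup>2) * (1 + ln (real n))"
    by (intro mult_left_mono sum_inverse_Suc_le assms sum_nonneg) auto
  finally show ?thesis .
qed

text \<open>The tangent line of \<open>x\<^sup>3\<close> at \<open>\<alpha> / sqrt (j + 1)\<close> makes the linear terms independent of \<open>j\<close>.\<close>

lemma sum_linear_weight_cube:
  fixes u :: "nat \<Rightarrow> real"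
  assumes "\<And>j. j < n \<Longrightarrow> 0 \<le> u j" "0 \<le> \<alpha>"
  shows "3 * \<alpha>\<^sup>2 * (\<Sum>j<n. u j) - 4 * \<alpha> ^ 3 * sqrt (real n) \<le> (\<Sum>j<n. (real j + 1) * u j ^ 3)"
proof -
  have tangent: "3 * b\<^sup>2 * x - 2 * b ^ 3 \<le> x ^ 3" if "0 \<le> x" "0 \<le> b" for x b :: real
  proof -
    have "x ^ 3 - (3 * b\<^sup>2 * x - 2 * b ^ 3) = (x - b)\<^sup>2 * (x + 2 * b)"
      by (simp add: power2_eq_square power3_eq_cube algebra_simps)
    also have "\<dots> \<ge> 0" using that by simp
    finally show ?thesis by simp
  qed
  have "3 * \<alpha>\<^sup>2 * u j - 2 * \<alpha> ^ 3 * (1 / sqrt (real j + 1)) \<le> (real j + 1) * u j ^ 3" if "j < n" for j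
  proof -
    define q where "q = sqrt (real j + 1)"
    have q: "0 < q" "real j + 1 = q * q" by (auto simp: q_def)
    have "q * q * (3 * (\<alpha> / q)\<^sup>2 * u j - 2 * (\<alpha> / q) ^ 3) \<le> q * q * u j ^ 3"
      using assms that q by (intro mult_left_mono tangent) auto
    moreover have "q * q * (3 * (\<alpha> / q)\<^sup>2 * u j - 2 * (\<alpha> / q) ^ 3) = 3 * \<alpha>\<^sup>2 * u j - 2 * \<alpha> ^ 3 * (1 / q)"
      using q(1) by (simp add: power2_eq_square power3_eq_cube field_simps)
    ultimately have "3 * \<alpha>\<^sup>2 * u j - 2 * \<alpha> ^ 3 * (1 / q) \<le> q * q * u j ^ 3" by linarith
    then have "3 * \<alpha>\<^sup>2 * u j - 2 * \<alpha> ^ 3 * (1 / q) \<le> (real j + 1) * u j ^ 3" by (simp only: q(2))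
    then show ?thesis by (simp only: q_def)
  qed
  then have "(\<Sum>j<n. 3 * \<alpha>\<^sup>2 * u j - 2 * \<alpha> ^ 3 * (1 / sqrt (real j + 1))) \<le> (\<Sum>j<n. (real j + 1) * u j ^ 3)"
    by (intro sum_mono) simp
  moreover have "(\<Sum>j<n. 3 * \<alpha>\<^sup>2 * u j - 2 * \<alpha> ^ 3 * (1 / sqrt (real j + 1)))
      = 3 * \<alpha>\<^sup>2 * (\<Sum>j<n. u j) - 2 * \<alpha> ^ 3 * (\<Sum>j<n. 1 / sqrt (real j + 1))"
    by (simp only: sum_subtractf sum_distrib_left)
  moreover have "2 * \<alpha> ^ 3 * (\<Sum>j<n. 1 / sqrt (real j + 1)) \<le> 2 * \<alpha> ^ 3 * (2 * sqrt (real n))"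
    using assms(2) by (intro mult_left_mono sum_inverse_sqrt_Suc_le) auto
  ultimately show ?thesis by linarith
qed

text \<open>Up to a constant, the exponent of the final bound; \<open>rate d r / r ^ d\<close> is
  the parameter \<open>\<theta>\<close> of the weight.\<close>

definition rate :: "nat \<Rightarrow> real \<Rightarrow> real" where
  "rate d r = (if d = 2 then r\<^sup>2 / ln r else r\<^sup>2)"

lemma sum_linear_weight_ge_rate:
  fixes u :: "nat \<Rightarrow> real"
  assumes d: "2 \<le> d" and c: "0 < c" "c \<le> 1" and r: "3 \<le> r"
    and u: "\<And>j. j < n \<Longrightarrow> 1 \<le> u j" "c * r \<le> (\<Sum>j<n. u j)" and n: "real n \<le> 2 * r"
  shows "c ^ 3 / 256 * rate d r \<le> (\<Sum>j<n. (real j + 1) * u j ^ d)"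
proof (cases "d = 2")
  case True
  have lnr: "1 \<le> ln r" using r exp_le by (subst ln_ge_iff) auto
  have "n \<noteq> 0" using u(2) c r by (intro notI) (simp add: mult_le_0_iff)
  then have n0: "0 < n" by simp
  have "ln (real n) \<le> ln (r\<^sup>2)"
  proof -
    have "2 * r \<le> r * r" using r by (intro mult_right_mono) auto
    then have "real n \<le> r\<^sup>2" using n by (simp only: power2_eq_square)
    then show ?thesis using n0 r by (subst ln_le_cancel_iff) auto
  qed
  then have ln: "1 + ln (real n) \<le> 3 * ln r" using lnr r by (simp add: ln_realpow)
  have pos: "0 \<le> (\<Sum>j<n. (real j + 1) * (u j)\<^sup>2)" by (intro sum_nonneg) auto
  have "(c * r)\<^sup>2 \<le> (\<Sum>j<n. u j)\<^sup>2" using u(2) c r by (intro power_mono) auto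
  also have "\<dots> \<le> (\<Sum>j<n. (real j + 1) * (u j)\<^sup>2) * (1 + ln (real n))"
    by (rule sum_linear_weight_square[OF n0])
  also have "\<dots> \<le> (\<Sum>j<n. (real j + 1) * (u j)\<^sup>2) * (3 * ln r)"
    using pos ln by (rule mult_left_mono[rotated])
  finally have "c\<^sup>2 * r\<^sup>2 / (3 * ln r) \<le> (\<Sum>j<n. (real j + 1) * (u j)\<^sup>2)"
    using lnr by (simp add: field_simps power_mult_distrib)
  moreover have "c ^ 3 / 256 * rate d r \<le> c\<^sup>2 * r\<^sup>2 / (3 * ln r)"
  proof -
    have "c ^ 3 / 256 \<le> c\<^sup>2 / 3"
    proof -
      have "c ^ 3 \<le> c\<^sup>2" using c by (intro power_decreasing) auto
      moreover have "0 \<le> c\<^sup>2" by simp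
      ultimately show ?thesis by linarith
    qed
    then have "c ^ 3 / 256 * (r\<^sup>2 / ln r) \<le> c\<^sup>2 / 3 * (r\<^sup>2 / ln r)"
      using lnr by (intro mult_right_mono) auto
    then show ?thesis by (simp add: rate_def True)
  qed
  ultimately show ?thesis using True by simp
next
  case False
  \<comment> \<open>As \<open>sqrt n \<le> 2 * sqrt r\<close>, this choice makes the subtracted term
    at most \<open>\<alpha>\<^sup>2 * (c * r / 2)\<close>, a fraction of the main term
    \<open>3 * \<alpha>\<^sup>2 * (c * r)\<close>.\<close>
  define \<alpha> where "\<alpha> = c / 16 * sqrt r"
  have sq: "\<alpha>\<^sup>2 = c\<^sup>2 / 256 * r" using r by (simp add: \<alpha>_def power_mult_distrib power_divide)
  have "sqrt (real n) \<le> 2 * sqrt r"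
  proof -
    have "sqrt (real n) \<le> sqrt (4 * r)" using n r by simp
    then show ?thesis by (simp add: real_sqrt_mult)
  qed
  then have "4 * \<alpha> ^ 3 * sqrt (real n) \<le> 4 * \<alpha> ^ 3 * (2 * sqrt r)"
    using c r by (intro mult_left_mono) (auto simp: \<alpha>_def)
  also have "\<dots> = \<alpha>\<^sup>2 * (8 * (\<alpha> * sqrt r))" by (simp add: power2_eq_square power3_eq_cube)
  also have "8 * (\<alpha> * sqrt r) = c * r / 2" using r by (simp add: \<alpha>_def)
  finally have 1: "4 * \<alpha> ^ 3 * sqrt (real n) \<le> \<alpha>\<^sup>2 * (c * r / 2)" .
  have 2: "3 * \<alpha>\<^sup>2 * (c * r) \<le> 3 * \<alpha>\<^sup>2 * (\<Sum>j<n. u j)"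
    using u(2) by (intro mult_left_mono) auto
  have "3 * \<alpha>\<^sup>2 * (\<Sum>j<n. u j) - 4 * \<alpha> ^ 3 * sqrt (real n) \<le> (\<Sum>j<n. (real j + 1) * u j ^ 3)"
    using u(1) c r by (intro sum_linear_weight_cube) (auto simp: \<alpha>_def intro: order_trans[OF zero_le_one])
  also have "\<dots> \<le> (\<Sum>j<n. (real j + 1) * u j ^ d)"
    using u(1) d False by (intro sum_mono mult_left_mono power_increasing) auto
  finally have "3 * \<alpha>\<^sup>2 * (\<Sum>j<n. u j) - 4 * \<alpha> ^ 3 * sqrt (real n) \<le> (\<Sum>j<n. (real j + 1) * u j ^ d)" .
  moreover have "0 \<le> \<alpha>\<^sup>2 * (c * r)" using c r by auto
  ultimately have "\<alpha>\<^sup>2 * (c * r) \<le> (\<Sum>j<n. (real j + 1) * u j ^ d)"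
    using 1 2 by linarith
  moreover have "\<alpha>\<^sup>2 * (c * r) = c ^ 3 / 256 * r\<^sup>2"
    unfolding sq by (simp add: power2_eq_square power3_eq_cube)
  ultimately show ?thesis using False by (simp add: rate_def)
qed

text \<open>If the sum were smaller, the levels with \<open>\<theta> * 2 ^ l < 1\<close> would have
  geometrically bounded widths adding up to at most \<open>c * r / 2\<close>. The other levels carry
  the rest, and there the logarithm grows at least linearly.\<close>

lemma sum_shell_weights_ge_rate:
  assumes d: "2 \<le> d" and c: "0 < c" "c \<le> 1"
  obtains \<kappa> where "0 < \<kappa>"
    "\<And>r n w. 3 \<le> r \<Longrightarrow> real n \<le> 2 * r \<Longrightarrow> (\<And>l. l < n \<Longrightarrow> 1 \<le> w l) \<Longrightarrow> c * r \<le> (\<Sum>l<n. w l) \<Longrightarrow>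
      \<kappa> * rate d r \<le> (\<Sum>l<n. ln (1 + rate d r / r ^ d * 2 ^ l) * w l ^ d)"
proof -
  define q where "q = root d 2"
  have q: "1 < q" "q ^ d = 2" using d by (auto simp: q_def)
  \<comment> \<open>With this factor the terms \<open>\<mu> * r * (1 / q) ^ l\<close> sum to at most
    \<open>c / 2 * r\<close>.\<close>
  define \<mu> where "\<mu> = c / 2 * (1 - 1 / q)"
  have \<mu>: "0 < \<mu>" using c q by (simp add: \<mu>_def)
  \<comment> \<open>One threshold for the early levels and one for the late ones;
    \<open>1024 = 4 * 256\<close> combines the losses from the logarithm and from
    \<open>sum_linear_weight_ge_rate\<close>.\<close>
  define \<kappa> where "\<kappa> = min (\<mu> ^ d / 2) ((c / 2) ^ 3 / 1024)"
  have \<kappa>: "0 < \<kappa>" using \<mu> c by (simp add: \<kappa>_def)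
  show thesis
  proof (rule that[OF \<kappa>])
    fix r :: real and n w
    assume r: "3 \<le> r" and n: "real n \<le> 2 * r" and w: "\<And>l. l < n \<Longrightarrow> 1 \<le> w l" and sum_w: "c * r \<le> (\<Sum>l<n. w l)"
    define \<theta> where "\<theta> = rate d r / r ^ d"
    let ?S = "\<Sum>l<n. ln (1 + \<theta> * 2 ^ l) * w l ^ d"
    have lnr: "1 \<le> ln r" using r exp_le by (subst ln_ge_iff) auto
    have rate: "0 < rate d r" using r lnr by (simp add: rate_def)
    have \<theta>: "0 < \<theta>" using r rate by (simp add: \<theta>_def)
    have rate_eq: "rate d r = \<theta> * r ^ d" using r by (simp add: \<theta>_def)
    have term_nonneg: "0 \<le> ln (1 + \<theta> * 2 ^ l) * w l ^ d" if "l < n" for l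
      using \<theta> w[OF that] by (intro mult_nonneg_nonneg ln_ge_zero) auto
    show "\<kappa> * rate d r \<le> (\<Sum>l<n. ln (1 + rate d r / r ^ d * 2 ^ l) * w l ^ d)"
    proof (rule ccontr)
      assume "\<not> ?thesis"
      then have S: "?S < \<kappa> * rate d r" by (simp add: \<theta>_def)
      have "\<exists>H. 1 \<le> \<theta> * 2 ^ H"
      proof -
        obtain H where "1 / \<theta> < 2 ^ H" using real_arch_pow[of 2 "1 / \<theta>"] by auto
        then show ?thesis using \<theta> by (intro exI[of _ H]) (simp add: field_simps)
      qed
      define H where "H = (LEAST H. 1 \<le> \<theta> * 2 ^ H)"
      have H: "1 \<le> \<theta> * 2 ^ H" "\<And>l. l < H \<Longrightarrow> \<theta> * 2 ^ l < 1"
        using LeastI_ex[OF \<open>\<exists>H. 1 \<le> \<theta> * 2 ^ H\<close>] not_less_Least[of _ "\<lambda>H. 1 \<le> \<theta> * 2 ^ H"]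
        by (auto simp: H_def not_le)
      have early: "w l \<le> \<mu> * r * (1 / q) ^ l" if "l < H" "l < n" for l
      proof -
        have "\<theta> * 2 ^ l / 2 * w l ^ d \<le> ln (1 + \<theta> * 2 ^ l) * w l ^ d"
          using H(2)[OF that(1)] \<theta> w[OF that(2)]
          by (intro mult_right_mono ln_one_plus_ge_half) auto
        also have "\<dots> \<le> ?S"
          using that(2) term_nonneg by (intro member_le_sum) auto
        also have "\<dots> \<le> \<mu> ^ d / 2 * rate d r"
        proof -
          have "\<kappa> * rate d r \<le> \<mu> ^ d / 2 * rate d r"
            using rate by (intro mult_right_mono) (auto simp: \<kappa>_def)
          then show ?thesis using S by linarith
        qed
        finally have "\<theta> * (2 ^ l * w l ^ d) \<le> \<theta> * (\<mu> ^ d * r ^ d)"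
          by (simp add: rate_eq algebra_simps)
        then have "2 ^ l * w l ^ d \<le> \<mu> ^ d * r ^ d" using \<theta> by simp
        moreover have "(2::real) ^ l = (q ^ l) ^ d"
          by (simp add: q(2)[symmetric] power_mult[symmetric] mult.commute)
        ultimately have "(q ^ l * w l) ^ d \<le> (\<mu> * r) ^ d" by (simp add: power_mult_distrib)
        then have "q ^ l * w l \<le> \<mu> * r"
          using power_le_imp_le_base[of "q ^ l * w l" "d - 1" "\<mu> * r"] d \<mu> r by simp
        then show ?thesis using q(1) by (simp add: field_simps)
      qed
      have "(\<Sum>l<min H n. w l) \<le> (\<Sum>l<min H n. \<mu> * r * (1 / q) ^ l)"
        by (intro sum_mono early) auto
      also have "\<dots> = \<mu> * r * (\<Sum>l<min H n. (1 / q) ^ l)"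
        by (simp only: sum_distrib_left)
      also have "\<dots> \<le> \<mu> * r * (1 / (1 - 1 / q))"
      proof (intro mult_left_mono)
        show "(\<Sum>l<min H n. (1 / q) ^ l) \<le> 1 / (1 - 1 / q)"
          using q(1) by (subst sum_gp_strict) (auto intro!: divide_right_mono)
      qed (use \<mu> r in auto)
      also have "\<dots> = c / 2 * r"
      proof -
        have "c / 2 * y * r * (1 / y) = c / 2 * r" if "y \<noteq> 0" for y using that by simp
        from this[of "1 - 1 / q"] show ?thesis unfolding \<mu>_def using q(1) by auto
      qed
      finally have first: "(\<Sum>l<min H n. w l) \<le> c / 2 * r" .
      \<comment> \<open>\<open>min H n\<close> covers the case that all levels come before
        \<open>H\<close>.\<close>
      have split: "(\<Sum>l<n. f l) = (\<Sum>l<min H n. f l) + (\<Sum>j<n - H. f (H + j))" for f :: "nat \<Rightarrow> real"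
      proof (cases "H \<le> n")
        case True
        then show ?thesis
          using sum.atLeastLessThan_concat[of 0 H n f] sum.shift_bounds_nat_ivl[of f 0 H "n - H"]
          by (simp add: atLeast0LessThan add.commute min_absorb1)
      next
        case False
        then have "min H n = n" "n - H = 0" by auto
        then show ?thesis by simp
      qed
      have "c / 2 * r \<le> (\<Sum>j<n - H. w (H + j))"
        using sum_w first split[of w] by (simp add: field_simps)
      then have "(c / 2) ^ 3 / 256 * rate d r \<le> (\<Sum>j<n - H. (real j + 1) * w (H + j) ^ d)"
        using d c r n w by (intro sum_linear_weight_ge_rate) auto
      also have "\<dots> \<le> (\<Sum>j<n - H. 4 * (ln (1 + \<theta> * 2 ^ (H + j)) * w (H + j) ^ d))"
      proof (rule sum_mono)
        fix j assume "j \<in> {..<n - H}"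
        then have wj: "1 \<le> w (H + j)" using w by simp
        have "1 * 2 ^ j \<le> \<theta> * 2 ^ H * 2 ^ j" by (intro mult_right_mono H(1)) simp
        then have "2 ^ j \<le> \<theta> * 2 ^ (H + j)" by (simp only: power_add mult.assoc mult_1)
        then have "ln (1 + 2 ^ j) \<le> ln (1 + \<theta> * 2 ^ (H + j))"
          using \<theta> by (subst ln_le_cancel_iff) (auto intro: add_pos_pos)
        then have "(real j + 1) / 4 \<le> ln (1 + \<theta> * 2 ^ (H + j))"
          by (rule order_trans[OF ln_one_plus_power2_ge])
        then have "real j + 1 \<le> 4 * ln (1 + \<theta> * 2 ^ (H + j))"
          by (simp add: field_simps)
        then have "(real j + 1) * w (H + j) ^ d \<le> 4 * ln (1 + \<theta> * 2 ^ (H + j)) * w (H + j) ^ d"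
          using wj by (intro mult_right_mono) auto
        then show "(real j + 1) * w (H + j) ^ d \<le> 4 * (ln (1 + \<theta> * 2 ^ (H + j)) * w (H + j) ^ d)"
          by simp
      qed
      also have "\<dots> = 4 * (\<Sum>j<n - H. ln (1 + \<theta> * 2 ^ (H + j)) * w (H + j) ^ d)"
        by (simp only: sum_distrib_left)
      also have "\<dots> \<le> 4 * ?S"
        unfolding split[of "\<lambda>l. ln (1 + \<theta> * 2 ^ l) * w l ^ d"]
        using term_nonneg by (auto intro!: sum_nonneg)
      finally have "(c / 2) ^ 3 / 1024 * rate d r \<le> ?S" by simp
      moreover have "\<kappa> * rate d r \<le> (c / 2) ^ 3 / 1024 * rate d r"
        using rate by (intro mult_right_mono) (auto simp: \<kappa>_def)
      ultimately show False using S by linarith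
    qed
  qed
qed

section \<open>The probability bound\<close>

lemma length_eq_num_walks:
  assumes "\<eta> \<in> configs" "xs \<in> walk_orderings \<eta>"
  shows "length xs = num_walks \<eta>"
proof -
  have c: "count_list xs z = \<eta> z" for z using assms(2) by (simp add: walk_orderings_def)
  have "set xs \<subseteq> {z. \<eta> z \<noteq> 0}"
    using c count_notin by (metis (mono_tags, lifting) count_list_0_iff mem_Collect_eq subsetI)
  then have "sum (count_list xs) {z. \<eta> z \<noteq> 0} = length xs"
    using assms(1) by (intro sum_count_set) (auto simp: configs_def)
  then show ?thesis by (simp add: num_walks_def c)
qed

lemma ln_cluster_weight:
  assumes "0 \<le> \<theta>"
  shows "cluster_weight a R \<theta> A = exp (\<Sum>x\<in>A. ln (1 + \<theta> * 2 ^ shell_depth a R A x))"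
proof (cases "finite A")
  case True
  have "exp (\<Sum>x\<in>A. ln (1 + \<theta> * 2 ^ shell_depth a R A x)) = (\<Prod>x\<in>A. exp (ln (1 + \<theta> * 2 ^ shell_depth a R A x)))"
    by (rule exp_sum[OF True])
  also have "\<dots> = cluster_weight a R \<theta> A"
    unfolding cluster_weight_def using assms by (intro prod.cong) (auto intro!: exp_ln add_pos_nonneg)
  finally show ?thesis by simp
qed (simp add: cluster_weight_def)

text \<open>Markov's inequality, with the lower bound on \<open>f\<close> only almost surely on the
  event.\<close>

lemma prob_le_of_nn_integral:
  assumes M: "prob_space M" and f: "(\<integral>\<^sup>+x. f x \<partial>M) \<le> ennreal B"
    and E: "{x \<in> space M. P x} \<in> sets M" and AE: "AE x in M. P x \<longrightarrow> ennreal C \<le> f x"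
    and pos: "0 < C" "0 \<le> B"
  shows "\<P>(x in M. P x) \<le> B / C"
proof -
  interpret prob_space M by (rule M)
  have "ennreal C * emeasure M {x \<in> space M. P x} = (\<integral>\<^sup>+x. ennreal C * indicator {x \<in> space M. P x} x \<partial>M)"
    using E by (simp add: nn_integral_cmult_indicator)
  also have "\<dots> \<le> (\<integral>\<^sup>+x. f x \<partial>M)"
    by (rule nn_integral_mono_AE) (use AE in eventually_elim, auto simp: indicator_def)
  also have "\<dots> \<le> ennreal B" by (rule f)
  finally have "ennreal (C * \<P>(x in M. P x)) \<le> ennreal B"
    using pos by (simp add: emeasure_eq_measure ennreal_mult)
  then have "C * \<P>(x in M. P x) \<le> B" using pos by simp
  then show ?thesis using pos by (simp add: field_simps)
qed

theorem corollary1p3: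
  assumes "CARD('d::finite) \<ge> 2"
  shows "\<exists>\<epsilon>>0. \<exists>\<kappa>>0. \<forall>\<^sub>F r::real in at_top.
    \<forall>\<eta> :: int ^ 'd \<Rightarrow> nat. \<forall>xs.
      \<eta> \<in> configs \<and> (\<forall>z \<in> lattice_ball 0 (2 * r). \<eta> z = 0) \<and>
      real (num_walks \<eta>) \<le> \<epsilon> * r ^ CARD('d) \<and> xs \<in> walk_orderings \<eta> \<longrightarrow>
        (CARD('d) = 2 \<longrightarrow>
          \<P>(\<omega> in walk_space. 0 \<in> idla_cluster xs \<omega>) \<le> exp (- \<kappa> * (r\<^sup>2 / ln r))) \<and>
        (CARD('d) \<ge> 3 \<longrightarrow>
          \<P>(\<omega> in walk_space. 0 \<in> idla_cluster xs \<omega>) \<le> exp (- \<kappa> * r\<^sup>2))"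
proof -
  define d where "d = CARD('d)"
  \<comment> \<open>Since \<open>32 * 32 = 4 * 256\<close>, the square of \<open>a\<close> dominates
    \<open>4 * exit_const\<close>.\<close>
  define a :: nat where "a = 32 * card (unit_steps :: (int ^ 'd) set) * 2 ^ d"
  have d: "2 \<le> d" using assms by (simp add: d_def)
  have a: "0 < a" using card_unit_steps_pos[where 'd='d] by (simp add: a_def)
  have a2: "4 * exit_const (card (unit_steps :: (int ^ 'd) set)) CARD('d) \<le> (real a)\<^sup>2"
  proof -
    have "(2::real) ^ d \<le> 2 ^ d * 2 ^ d" by simp
    then have "1024 * (real (card (unit_steps :: (int ^ 'd) set)))\<^sup>2 * 2 ^ d
        \<le> 1024 * (real (card (unit_steps :: (int ^ 'd) set)))\<^sup>2 * (2 ^ d * 2 ^ d)"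
      by (intro mult_left_mono) auto
    then show ?thesis by (simp add: exit_const_def a_def d_def power2_eq_square algebra_simps)
  qed
  \<comment> \<open>Read off from
    \<open>r / d \<le> R \<le> 4 * a * (\<Sum>l<n. w l)\<close>.\<close>
  define c where "c = 1 / (4 * real a * real d)"
  have "1 * 1 \<le> real a * real d" using a d by (intro mult_mono) auto
  then have c: "0 < c" "c \<le> 1" by (auto simp: c_def field_simps)
  obtain \<kappa>\<^sub>0 where \<kappa>\<^sub>0: "0 < \<kappa>\<^sub>0"
    and rate: "\<And>r n w. 3 \<le> r \<Longrightarrow> real n \<le> 2 * r \<Longrightarrow> (\<And>l. l < n \<Longrightarrow> 1 \<le> w l) \<Longrightarrow> c * r \<le> (\<Sum>l<n. w l) \<Longrightarrow>
      \<kappa>\<^sub>0 * rate d r \<le> (\<Sum>l<n. ln (1 + rate d r / r ^ d * 2 ^ l) * w l ^ d)"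
    using sum_shell_weights_ge_rate[OF d c] by blast
  \<comment> \<open>The factor \<open>2 ^ d\<close> comes from \<open>(w l / 2) ^ d\<close>; the
    last 2 pays for the growth of the expected weight.\<close>
  define \<kappa> where "\<kappa> = \<kappa>\<^sub>0 / 2 ^ d / 2"
  \<comment> \<open>The first bound keeps the expected weight below
    \<open>exp (\<kappa> * rate d r)\<close>, the second makes the whole cluster thin at a scale
    that fits into radius \<open>R\<close>.\<close>
  define \<epsilon> where "\<epsilon> = min (\<kappa> / 2) ((1 / (8 * real a * real d)) ^ d)"
  have \<kappa>: "0 < \<kappa>" using \<kappa>\<^sub>0 by (simp add: \<kappa>_def)
  have \<epsilon>: "0 < \<epsilon>" using \<kappa> a d by (simp add: \<epsilon>_def)
  have main: "\<P>(\<omega> in walk_space. 0 \<in> idla_cluster xs \<omega>) \<le> exp (- \<kappa> * rate d r)"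
    if r: "3 \<le> r" "4 * real a * real d \<le> r" and \<eta>: "\<eta> \<in> configs" "\<And>z. z \<in> lattice_ball 0 (2 * r) \<Longrightarrow> \<eta> z = 0"
      "real (num_walks \<eta>) \<le> \<epsilon> * r ^ d" "xs \<in> walk_orderings \<eta>"
    for r :: real and \<eta> :: "int ^ 'd \<Rightarrow> nat" and xs
  proof -
    let ?W = "walk_space :: (nat \<times> nat \<Rightarrow> int ^ 'd) measure"
    \<comment> \<open>The Euclidean norm is at most \<open>d\<close> times the sup norm, so every
      start outside the ball of radius \<open>2 * r\<close> has level at least
      \<open>R\<close>.\<close>
    define R where "R = nat \<lfloor>2 * r / real d\<rfloor>"
    define \<theta> where "\<theta> = rate d r / r ^ d"
    let ?N = "length xs"
    have "1 \<le> ln r" using r exp_le by (subst ln_ge_iff) auto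
    then have "0 < rate d r" using r by (simp add: rate_def)
    then have \<theta>: "0 < \<theta>" using r by (simp add: \<theta>_def)
    have "1 * real d \<le> 4 * real a * real d" using a d by (intro mult_right_mono) auto
    then have "real d \<le> r" using r(2) by linarith
    then have "1 \<le> r / real d" using d by (simp add: field_simps)
    then have R: "r / real d \<le> real R" "real R \<le> 2 * r / real d" "real R \<le> 2 * r"
    proof -
      show "r / real d \<le> real R" "real R \<le> 2 * r / real d"
        unfolding R_def using \<open>1 \<le> r / real d\<close> by linarith+
      moreover have "2 * r / real d \<le> 2 * r" using r d by (simp add: field_simps)
      ultimately show "real R \<le> 2 * r" by linarith
    qed
    have N: "real ?N \<le> \<epsilon> * r ^ d" using \<eta> length_eq_num_walks by metis
    have far: "R \<le> sup_norm x" if "x \<in> set xs" for x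
    proof -
      have "\<eta> x \<noteq> 0"
        using that \<eta>(4) count_list_0_iff[of xs x] by (auto simp: walk_orderings_def)
      then have "2 * r \<le> norm (lattice_vec x)"
        using \<eta>(2)[of x] by (force simp: lattice_ball_def)
      also have "\<dots> \<le> real d * real (sup_norm x)"
        unfolding d_def by (rule norm_lattice_vec_le)
      finally have "2 * r / real d \<le> real (sup_norm x)" using d by (simp add: field_simps)
      then show ?thesis using R(2) by linarith
    qed
    have k: "\<exists>k. 4 * a * 2 ^ k \<le> R \<and> ?N < 2 ^ (d * k)"
    proof -
      have "4 * real a \<le> r / real d" using r(2) d by (simp add: field_simps)
      then have "real (4 * a) \<le> real R" using R(1) by simp
      then have "4 * a * 2 ^ 0 \<le> R" by simp
      moreover have "k \<le> R" if "4 * a * 2 ^ k \<le> R" for k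
      proof -
        have "k < 2 ^ k" by (rule less_exp)
        also have "(2::nat) ^ k \<le> 4 * a * 2 ^ k" using a by simp
        finally show ?thesis using that by linarith
      qed
      \<comment> \<open>Maximality of \<open>k\<close> gives \<open>2 ^ k > r / (8 * a * d)\<close>,
        hence \<open>2 ^ (d * k)\<close> exceeds the number of walks.\<close>
      ultimately obtain k where k: "4 * a * 2 ^ k \<le> R" "\<And>l. 4 * a * 2 ^ l \<le> R \<Longrightarrow> l \<le> k"
        using Nat.ex_has_greatest_nat[of "\<lambda>k. 4 * a * 2 ^ k \<le> R" 0 R] by blast
      then have "\<not> 4 * a * 2 ^ Suc k \<le> R" using Suc_n_not_le_n by blast
      then have "real R < real (4 * a * 2 ^ Suc k)" by (simp only: of_nat_less_iff not_le)
      then have "r / real d < 8 * real a * 2 ^ k" using R(1) by simp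
      then have "1 / (8 * real a * real d) * r < 2 ^ k" using a d by (simp add: field_simps)
      then have "(1 / (8 * real a * real d) * r) ^ d < (2 ^ k) ^ d"
        using a d r by (intro power_strict_mono) auto
      moreover have "\<epsilon> * r ^ d \<le> (1 / (8 * real a * real d)) ^ d * r ^ d"
        using r by (intro mult_right_mono) (auto simp: \<epsilon>_def)
      ultimately have "real ?N < (2 ^ k) ^ d" using N unfolding power_mult_distrib[of _ r] by linarith
      moreover have "real (2 ^ (d * k)) = (2 ^ k) ^ d" by (simp add: mult.commute[of d] power_mult)
      ultimately have "real ?N < real (2 ^ (d * k))" by linarith
      then show ?thesis using k(1) by (intro exI[of _ k]) (simp only: of_nat_less_iff)
    qed
    have heavy: "exp (2 * \<kappa> * rate d r) \<le> cluster_weight a R \<theta> (idla_cluster xs \<omega>)"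
      if \<omega>: "\<forall>p. \<omega> p \<in> unit_steps" and zero: "0 \<in> idla_cluster xs \<omega>" for \<omega>
    proof -
      let ?A = "idla_cluster xs \<omega>"
      define \<Gamma> :: "nat \<Rightarrow> real" where "\<Gamma> l = ln (1 + \<theta> * 2 ^ l)" for l
      have fin: "finite ?A" unfolding idla_cluster_def by (rule finite_cluster_after)
      have "levels_filled R ?A"
        unfolding idla_cluster_def by (rule levels_filled_cluster_after) (use far \<omega> in auto)
      then have filled: "\<exists>y\<in>?A. sup_norm y = s" if "s < R" for s
        using zero that unfolding levels_filled_def by force
      obtain k where "4 * a * 2 ^ k \<le> R" "?N < 2 ^ (d * k)" using k by blast
      moreover have "card ?A \<le> ?N" unfolding idla_cluster_def by (rule card_cluster_after_le)
      ultimately have k: "4 * a * 2 ^ k \<le> R" "card ?A < 2 ^ (CARD('d) * k)" by (auto simp: d_def)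
      have "mono \<Gamma>"
      proof (rule monoI)
        fix l l' :: nat assume "l \<le> l'"
        then have "\<theta> * 2 ^ l \<le> \<theta> * 2 ^ l'" using \<theta> by (intro mult_left_mono power_increasing) auto
        then show "\<Gamma> l \<le> \<Gamma> l'" using \<theta> by (simp add: \<Gamma>_def add_pos_pos)
      qed
      moreover have "0 \<le> \<Gamma> l" for l using \<theta> by (simp add: \<Gamma>_def)
      ultimately obtain n w where nw: "n \<le> R" "\<And>l. l < n \<Longrightarrow> 1 \<le> w l" "real R \<le> 4 * real a * (\<Sum>l<n. w l)"
        "(\<Sum>l<n. \<Gamma> l * (w l / 2) ^ CARD('d)) \<le> (\<Sum>x\<in>?A. \<Gamma> (shell_depth a R ?A x))"
        using shell_decomposition[OF fin filled a k, of \<Gamma>] by blast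
      have "r / real d \<le> 4 * real a * (\<Sum>l<n. w l)" using R(1) nw(3) by linarith
      then have "c * r \<le> (\<Sum>l<n. w l)" using a d by (simp add: c_def field_simps)
      moreover have "real n \<le> 2 * r" using nw(1) R(3) by linarith
      ultimately have "\<kappa>\<^sub>0 * rate d r \<le> (\<Sum>l<n. \<Gamma> l * w l ^ d)"
        using rate[OF r(1), of n w] nw(2) by (simp add: \<Gamma>_def \<theta>_def)
      then have "\<kappa>\<^sub>0 * rate d r / 2 ^ d \<le> (\<Sum>l<n. \<Gamma> l * w l ^ d) / 2 ^ d"
        by (rule divide_right_mono) simp
      also have "\<dots> = (\<Sum>l<n. \<Gamma> l * (w l / 2) ^ CARD('d))"
        by (simp add: sum_divide_distrib power_divide d_def)
      finally have "2 * \<kappa> * rate d r \<le> (\<Sum>x\<in>?A. \<Gamma> (shell_depth a R ?A x))"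
        using nw(4) by (simp add: \<kappa>_def)
      then show ?thesis
        using \<theta> by (simp add: ln_cluster_weight \<Gamma>_def)
    qed
    have "\<P>(\<omega> in ?W. 0 \<in> idla_cluster xs \<omega>) \<le> (1 + 2 * \<theta>) ^ ?N / exp (2 * \<kappa> * rate d r)"
    proof (rule prob_le_of_nn_integral[OF prob_space_walk_space])
      show "(\<integral>\<^sup>+\<omega>. ennreal (cluster_weight a R \<theta> (idla_cluster xs \<omega>)) \<partial>?W) \<le> ennreal ((1 + 2 * \<theta>) ^ ?N)"
        unfolding idla_cluster_def using \<theta> by (intro nn_integral_cluster_weight a a2 far) auto
      show "{\<omega> \<in> space ?W. 0 \<in> idla_cluster xs \<omega>} \<in> sets ?W" by (rule idla_event_measurable)
      show "AE \<omega> in ?W. 0 \<in> idla_cluster xs \<omega> \<longrightarrow>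
          ennreal (exp (2 * \<kappa> * rate d r)) \<le> ennreal (cluster_weight a R \<theta> (idla_cluster xs \<omega>))"
        using AE_unit_steps by eventually_elim (auto intro!: ennreal_leI heavy)
    qed (use \<theta> in auto)
    also have "(1 + 2 * \<theta>) ^ ?N \<le> exp (\<kappa> * rate d r)"
    proof -
      have "(1 + 2 * \<theta>) ^ ?N \<le> exp (2 * \<theta>) ^ ?N"
        using \<theta> by (intro power_mono exp_ge_add_one_self) auto
      also have "\<dots> = exp (real ?N * (2 * \<theta>))" by (rule exp_of_nat_mult[symmetric])
      also have "real ?N * (2 * \<theta>) \<le> \<kappa> / 2 * r ^ d * (2 * \<theta>)"
      proof (rule mult_right_mono)
        have "\<epsilon> * r ^ d \<le> \<kappa> / 2 * r ^ d" using r by (intro mult_right_mono) (auto simp: \<epsilon>_def)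
        then show "real ?N \<le> \<kappa> / 2 * r ^ d" using N by linarith
      qed (use \<theta> in auto)
      also have "\<dots> = \<kappa> * rate d r" using r by (simp add: \<theta>_def)
      finally show ?thesis by simp
    qed
    also have "exp (\<kappa> * rate d r) / exp (2 * \<kappa> * rate d r) = exp (- \<kappa> * rate d r)"
      by (simp flip: exp_diff)
    finally show ?thesis by (simp add: divide_right_mono)
  qed
  have "\<forall>\<^sub>F r::real in at_top.
    \<forall>\<eta> :: int ^ 'd \<Rightarrow> nat. \<forall>xs.
      \<eta> \<in> configs \<and> (\<forall>z \<in> lattice_ball 0 (2 * r). \<eta> z = 0) \<and>
      real (num_walks \<eta>) \<le> \<epsilon> * r ^ CARD('d) \<and> xs \<in> walk_orderings \<eta> \<longrightarrow>
        (CARD('d) = 2 \<longrightarrow>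
          \<P>(\<omega> in walk_space. 0 \<in> idla_cluster xs \<omega>) \<le> exp (- \<kappa> * (r\<^sup>2 / ln r))) \<and>
        (CARD('d) \<ge> 3 \<longrightarrow>
          \<P>(\<omega> in walk_space. 0 \<in> idla_cluster xs \<omega>) \<le> exp (- \<kappa> * r\<^sup>2))"
    using eventually_ge_at_top[of 3] eventually_ge_at_top[of "4 * real a * real d"]
  proof eventually_elim
    case (elim r)
    then show ?case
      using main[of r] by (auto simp: rate_def d_def)
  qed
  with \<epsilon> \<kappa> show ?thesis by blast
qed

end
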